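(* Let $f,g:[0,\infty)\to[0,\infty)$ be two measurable (capacity) functions with $m(f)<\infty$ and $m(g)<\infty$. Then $$\operatorname{cov}\big(S_o(f),S_o(g)\big)\ \le\ m(f\cdot g)+m(f)\,n(g)-m(f)\,m(g),$$ where $$n(g)=\lambda_M\int_0^\infty B'(t)g(t)\,dt\in[0,\infty].$$
   Context: Base stations: $\Pi_B=\{y_0,y_1,\dots\}$ is a homogeneous Poisson point process on $\mathbb{R}^2$ of intensity $\lambda_B>0$. Users: $\Pi_M=\{x_0,x_1,\dots\}$ is a homogeneous Poisson point process on $\mathbb{R}^2$ of intensity $\lambda_M>0$, independent of $\Pi_B$. Path loss: $L:\mathbb{R}^2\to(0,\infty)$ is a measurable function (values on a Lebesgue-null set are irrelevant). Fading: $H$ is a nonnegative random variable with probability density function $p_H$ and complementary cumulative distribution function $F_H(\beta)=P(H\ge\beta)=\int_\beta^\infty p_H(t)\,dt$, assumed to satisfy $F_H(\beta)>0$ for all $\beta$. Define $B(\beta)=\int_{\mathbb{R}^2}F_H\big((L(z)\beta)^{-1}\big)\,dz$ for $\beta>0$; it is assumed that $0<B(\beta)<\infty$ for all $\beta>0$. $B$ is nondecreasing, and $B'$ denotes its derivative (defined for almost every $\beta$). The typical base station is an additional base station placed at the origin $o$. To each pair $(y,x)$ with $y$ a base station ($y\in\Pi_B\cup\{o\}$) and $x$ a user location is attached a fading variable $h_{yx}$; given $\Pi_B$ and $\Pi_M$, all these variables are independent copies of $H$. Put $s_{yx}=\big(h_{yx}L(y-x)\big)^{-1}$ and let $\xi_0^x=\min_{y\in\Pi_B}s_{yx}$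 be the smallest path loss fading at $x$ among the base stations of $\Pi_B$ (not counting $o$). A user $x$ is served by $o$ iff $s_{ox}<\xi_0^x$. The cell capacity of the typical base station is $S_o(f)=\sum_{x\in\Pi_M}\mathbf{1}(s_{ox}<\xi_0^x)\,f(s_{ox})$, and $m(f)=E(S_o(f))\in[0,\infty]$. The product $f\cdot g$ is the pointwise product. The covariance is $\operatorname{cov}(S_o(f),S_o(g))=E(S_o(f)S_o(g))-m(f)m(g)$, which may equal $+\infty$; the convention $0\cdot\infty=0$ is used, and the inequality is trivial when its right-hand side is $+\infty$. *)

theory Defs
  imports "HOL-Probability.Probability"
begin

(* A point process is represented by an enumeration (Y i) of its points; the number of points in A
   counts indices. Intensities below are diffuse, so almost surely no point is repeated. *)
definition point_count :: "(nat \<Rightarrow> 'w \<Rightarrow> 'a) \<Rightarrow> 'a set \<Rightarrow> 'w \<Rightarrow> ennreal" where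
  "point_count Y A \<omega> = (\<Sum>i. indicator A (Y i \<omega>))"

(* For rate > 0 there are almost surely infinitely many points, so enumeration by nat loses nothing. *)
definition homogeneous_ppp ::
  "'w measure \<Rightarrow> real \<Rightarrow> (nat \<Rightarrow> 'w \<Rightarrow> 'a::euclidean_space) \<Rightarrow> bool" where
  "homogeneous_ppp M rate Y \<longleftrightarrow>
     (\<forall>i. Y i \<in> borel_measurable M) \<and>
     (\<forall>A\<in>sets borel. emeasure lborel A < \<infinity> \<longrightarrow>
        (\<forall>k::nat. measure M {\<omega> \<in> space M. point_count Y A \<omega> = of_nat k}
           = (rate * measure lborel A) ^ k / fact k * exp (- (rate * measure lborel A)))) \<and>
     (\<forall>(A :: nat \<Rightarrow> 'a set) n. range A \<subseteq> sets borel \<longrightarrow> disjoint_family_on A {..<n} \<longrightarrow>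
        prob_space.indep_vars M (\<lambda>_. borel) (\<lambda>i. point_count Y (A i)) {..<n})"

(* Independence of the point processes themselves, i.e. of the sigma-algebras generated by their
   counting variables; the enumerations may carry additional, dependent, randomness. *)
definition indep_point_processes ::
  "'w measure \<Rightarrow> (nat \<Rightarrow> 'w \<Rightarrow> 'a::topological_space) \<Rightarrow> (nat \<Rightarrow> 'w \<Rightarrow> 'a) \<Rightarrow> bool" where
  "indep_point_processes M Y X \<longleftrightarrow>
     prob_space.indep_var M
       (PiM (sets borel) (\<lambda>_. borel)) (\<lambda>\<omega>. \<lambda>A\<in>sets borel. point_count Y A \<omega>)
       (PiM (sets borel) (\<lambda>_. borel)) (\<lambda>\<omega>. \<lambda>A\<in>sets borel. point_count X A \<omega>)"

(* The fading variable of base station a and user j is h (a, j), where a = None is the typical base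
   station at the origin and a = Some i is the i-th point of the base station process. Independence
   is from the enumerated points, so that h (a, j) really is attached to the pair of points. *)
definition iid_fading ::
  "'w measure \<Rightarrow> ('w \<Rightarrow> real) \<Rightarrow> (nat \<Rightarrow> 'w \<Rightarrow> real^2) \<Rightarrow> (nat \<Rightarrow> 'w \<Rightarrow> real^2) \<Rightarrow>
     (nat option \<times> nat \<Rightarrow> 'w \<Rightarrow> real) \<Rightarrow> bool" where
  "iid_fading M H Y X h \<longleftrightarrow>
     (\<forall>p. h p \<in> borel_measurable M \<and> distr M borel (h p) = distr M borel H) \<and>
     prob_space.indep_vars M (\<lambda>_. borel) h UNIV \<and>
     prob_space.indep_set M
       (sets (vimage_algebra (space M) (\<lambda>\<omega> p. h p \<omega>) (PiM UNIV (\<lambda>_. borel))))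
       (sets (vimage_algebra (space M) (\<lambda>\<omega>. (\<lambda>i. Y i \<omega>, \<lambda>j. X j \<omega>))
          (PiM UNIV (\<lambda>_. borel) \<Otimes>\<^sub>M PiM UNIV (\<lambda>_. borel))))"

definition ccdf :: "'w measure \<Rightarrow> ('w \<Rightarrow> real) \<Rightarrow> real \<Rightarrow> real" where
  "ccdf M H \<beta> = measure M {\<omega> \<in> space M. H \<omega> \<ge> \<beta>}"

definition path_loss_intensity :: "(real \<Rightarrow> real) \<Rightarrow> (real^2 \<Rightarrow> real) \<Rightarrow> real \<Rightarrow> real" where
  "path_loss_intensity F L \<beta> = (\<integral>z. F (inverse (L z * \<beta>)) \<partial>lborel)"

definition station_loc :: "(nat \<Rightarrow> 'w \<Rightarrow> real^2) \<Rightarrow> nat option \<Rightarrow> 'w \<Rightarrow> real^2" where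
  "station_loc Y a \<omega> = (case a of None \<Rightarrow> 0 | Some i \<Rightarrow> Y i \<omega>)"

(* Taken in ennreal, so that vanishing fading (a null event) gives infinite path loss. *)
definition path_loss_fading ::
  "(real^2 \<Rightarrow> real) \<Rightarrow> (nat \<Rightarrow> 'w \<Rightarrow> real^2) \<Rightarrow> (nat \<Rightarrow> 'w \<Rightarrow> real^2) \<Rightarrow>
     (nat option \<times> nat \<Rightarrow> 'w \<Rightarrow> real) \<Rightarrow> nat option \<Rightarrow> nat \<Rightarrow> 'w \<Rightarrow> ennreal" where
  "path_loss_fading L Y X h a j \<omega> =
     inverse (ennreal (h (a, j) \<omega> * L (station_loc Y a \<omega> - X j \<omega>)))"

(* The infimum is almost surely a minimum when path_loss_intensity (the function B) is finite. *)
definition min_path_loss_fading ::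
  "(real^2 \<Rightarrow> real) \<Rightarrow> (nat \<Rightarrow> 'w \<Rightarrow> real^2) \<Rightarrow> (nat \<Rightarrow> 'w \<Rightarrow> real^2) \<Rightarrow>
     (nat option \<times> nat \<Rightarrow> 'w \<Rightarrow> real) \<Rightarrow> nat \<Rightarrow> 'w \<Rightarrow> ennreal" where
  "min_path_loss_fading L Y X h j \<omega> = (INF i. path_loss_fading L Y X h (Some i) j \<omega>)"

definition cell_capacity ::
  "(real^2 \<Rightarrow> real) \<Rightarrow> (nat \<Rightarrow> 'w \<Rightarrow> real^2) \<Rightarrow> (nat \<Rightarrow> 'w \<Rightarrow> real^2) \<Rightarrow>
     (nat option \<times> nat \<Rightarrow> 'w \<Rightarrow> real) \<Rightarrow> (real \<Rightarrow> real) \<Rightarrow> 'w \<Rightarrow> ennreal" where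
  "cell_capacity L Y X h f \<omega> =
     (\<Sum>j. if path_loss_fading L Y X h None j \<omega> < min_path_loss_fading L Y X h j \<omega>
          then ennreal (f (enn2real (path_loss_fading L Y X h None j \<omega>))) else 0)"

definition mean_capacity ::
  "'w measure \<Rightarrow> (real^2 \<Rightarrow> real) \<Rightarrow> (nat \<Rightarrow> 'w \<Rightarrow> real^2) \<Rightarrow> (nat \<Rightarrow> 'w \<Rightarrow> real^2) \<Rightarrow>
     (nat option \<times> nat \<Rightarrow> 'w \<Rightarrow> real) \<Rightarrow> (real \<Rightarrow> real) \<Rightarrow> ennreal" where
  "mean_capacity M L Y X h f = (\<integral>\<^sup>+\<omega>. cell_capacity L Y X h f \<omega> \<partial>M)"

(* Meaningful when both means are finite; the value may then be infinite. *)
definition ext_cov :: "'w measure \<Rightarrow> ('w \<Rightarrow> ennreal) \<Rightarrow> ('w \<Rightarrow> ennreal) \<Rightarrow> ereal" where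
  "ext_cov M U V = enn2ereal (\<integral>\<^sup>+\<omega>. U \<omega> * V \<omega> \<partial>M)
     - enn2ereal (\<integral>\<^sup>+\<omega>. U \<omega> \<partial>M) * enn2ereal (\<integral>\<^sup>+\<omega>. V \<omega> \<partial>M)"

(* deriv is unspecified only on the null set where B is not differentiable, which does not affect
   the integral. *)
definition n_capacity :: "real \<Rightarrow> (real \<Rightarrow> real) \<Rightarrow> (real \<Rightarrow> real) \<Rightarrow> ennreal" where
  "n_capacity lamM B g = ennreal lamM * (\<integral>\<^sup>+t\<in>{0<..}. ennreal (deriv B t * g t) \<partial>lborel)"

end

theory Submission
  imports Defs
begin

text \<open>
Expand the product of the two sums over users. The diagonal terms, where both factors belong to the
same user, are the terms of the cell capacity of \<open>f \<cdot> g\<close>. In an off-diagonal term, for users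
\<open>j \<noteq> k\<close>, the requirement that user \<open>k\<close> is served is dropped. This is the only inequality in the proof
(\<open>product_capacity_le\<close>), and it is what makes the two users independent: the base stations and the
fading that decide whether user \<open>k\<close> is served no longer occur in its factor.

What remains of the off-diagonal part is computed exactly. The fading variable of the link from the
origin to user \<open>k\<close> is independent of all fading variables at user \<open>j\<close>, so averaging over the fading
turns the sum into \<open>\<Sum>j\<noteq>k. \<Phi>(Y, X j) \<Gamma>(X k)\<close>, where \<open>\<Phi>\<close> (\<open>mean_served\<close>) is the expected
contribution of a user at a given place to the capacity of \<open>f\<close> and \<open>\<Gamma>\<close> is the expected value of \<open>g\<close> at
the path loss fading from the origin. The second order Campbell formula of the user process, which is
Poisson and independent of \<open>Y\<close>, factorizes the expectation of this sum as
\<open>E (\<Sum>j. \<Phi>(Y, X j))\<close> times \<open>lamM \<integral> \<Gamma>\<close> (\<open>mean_served_pairs_factor\<close>); the first factor is \<open>m(f)\<close>.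

The second factor is \<open>n(g)\<close> (\<open>n_capacity_eq\<close>). The image of Lebesgue measure times the law of \<open>H\<close>
under \<open>(z, t) \<mapsto> 1 / (t L(z))\<close> has the distribution function \<open>B\<close>, and it is absolutely continuous
because \<open>H\<close> has a density. By Lebesgue's differentiation theorem its density is \<open>B'\<close> almost everywhere.

A delicate point is the use of independence. The processes \<open>Y\<close> and \<open>X\<close> are independent only through
their counting variables, while \<open>\<Phi>(Y, x)\<close> is given by the enumeration of \<open>Y\<close>. It has to be shown that
\<open>\<Phi>(Y, x)\<close> depends on the counts of \<open>Y\<close> alone, measurably and jointly with \<open>x\<close>. Given the path loss
fading from the origin, the probability that no base station does better is an infinite product over
the base stations; in the form \<open>exp (- \<Sum>i. - ln u(Y i))\<close> it is a function of a sum over points, and such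
sums are accessible from the counts by a monotone class argument (\<open>measurable_sum_points\<close>).
\<close>

section \<open>Integrating out an independent component\<close>

text \<open>Fubini's theorem for an independent pair. The two components may have different types, which
\<open>indep_var\<close> excludes, so independence is expressed on rectangles.\<close>

lemma (in prob_space) nn_integral_product_law:
  assumes [measurable]: "U \<in> measurable M S" "V \<in> measurable M T"
    and rect: "\<And>A B. A \<in> sets S \<Longrightarrow> B \<in> sets T \<Longrightarrow>
      prob ((U -` A \<inter> space M) \<inter> (V -` B \<inter> space M)) = prob (U -` A \<inter> space M) * prob (V -` B \<inter> space M)"
    and \<Psi> [measurable]: "\<Psi> \<in> borel_measurable (S \<Otimes>\<^sub>M T)"
  shows "(\<integral>\<^sup>+\<omega>. \<Psi> (U \<omega>, V \<omega>) \<partial>M) = (\<integral>\<^sup>+\<omega>. \<integral>\<^sup>+\<omega>'. \<Psi> (U \<omega>', V \<omega>) \<partial>M \<partial>M)"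
proof -
  interpret U: prob_space "distr M S U" by (rule prob_space_distr) simp
  interpret V: prob_space "distr M T V" by (rule prob_space_distr) simp
  interpret UV: pair_sigma_finite "distr M S U" "distr M T V" ..
  have eq: "distr M S U \<Otimes>\<^sub>M distr M T V = distr M (S \<Otimes>\<^sub>M T) (\<lambda>\<omega>. (U \<omega>, V \<omega>))"
  proof (rule pair_measure_eqI)
    fix A B assume "A \<in> sets (distr M S U)" "B \<in> sets (distr M T V)"
    then have [measurable]: "A \<in> sets S" "B \<in> sets T" by simp_all
    have "emeasure (distr M (S \<Otimes>\<^sub>M T) (\<lambda>\<omega>. (U \<omega>, V \<omega>))) (A \<times> B) =
        emeasure M ((U -` A \<inter> space M) \<inter> (V -` B \<inter> space M))"
      by (subst emeasure_distr) (auto intro!: arg_cong[where f = "emeasure M"])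
    then show "emeasure (distr M S U) A * emeasure (distr M T V) B =
        emeasure (distr M (S \<Otimes>\<^sub>M T) (\<lambda>\<omega>. (U \<omega>, V \<omega>))) (A \<times> B)"
      by (simp add: emeasure_distr emeasure_eq_measure rect ennreal_mult)
  qed (auto intro: U.sigma_finite_measure_axioms V.sigma_finite_measure_axioms)
  have "(\<integral>\<^sup>+\<omega>. \<Psi> (U \<omega>, V \<omega>) \<partial>M) = (\<integral>\<^sup>+z. \<Psi> z \<partial>(distr M S U \<Otimes>\<^sub>M distr M T V))"
    unfolding eq by (subst nn_integral_distr) auto
  also have "\<dots> = (\<integral>\<^sup>+v. \<integral>\<^sup>+u. \<Psi> (u, v) \<partial>distr M S U \<partial>distr M T V)"
    by (subst UV.nn_integral_snd[symmetric]) auto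
  also have "\<dots> = (\<integral>\<^sup>+\<omega>. \<integral>\<^sup>+u. \<Psi> (u, V \<omega>) \<partial>distr M S U \<partial>M)"
    by (subst nn_integral_distr) auto
  also have "\<dots> = (\<integral>\<^sup>+\<omega>. \<integral>\<^sup>+\<omega>'. \<Psi> (U \<omega>', V \<omega>) \<partial>M \<partial>M)"
    by (intro nn_integral_cong, subst nn_integral_distr) (auto dest: measurable_space[OF \<open>V \<in> measurable M T\<close>])
  finally show ?thesis .
qed

lemma (in prob_space) indep_var_nn_integral:
  assumes ind: "indep_var S U T V" and \<Psi>: "\<Psi> \<in> borel_measurable (S \<Otimes>\<^sub>M T)"
  shows "(\<integral>\<^sup>+\<omega>. \<Psi> (U \<omega>, V \<omega>) \<partial>M) = (\<integral>\<^sup>+\<omega>. \<integral>\<^sup>+\<omega>'. \<Psi> (U \<omega>', V \<omega>) \<partial>M \<partial>M)"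
proof (rule nn_integral_product_law[OF _ _ _ \<Psi>])
  show "U \<in> measurable M S" "V \<in> measurable M T"
    using ind by (auto simp: indep_var_eq)
  fix A B assume AB: "A \<in> sets S" "B \<in> sets T"
  have "U -` A \<inter> space M \<inter> (V -` B \<inter> space M) = (\<lambda>\<omega>. (U \<omega>, V \<omega>)) -` (A \<times> B) \<inter> space M" by auto
  then show "prob ((U -` A \<inter> space M) \<inter> (V -` B \<inter> space M)) = prob (U -` A \<inter> space M) * prob (V -` B \<inter> space M)"
    using indep_varD[OF ind AB] by simp
qed

lemma (in prob_space) indep_var_nn_integral_mult:
  assumes ind: "indep_var S U T V"
    and [measurable]: "\<phi> \<in> borel_measurable S" "\<psi> \<in> borel_measurable T"
  shows "(\<integral>\<^sup>+\<omega>. \<phi> (U \<omega>) * \<psi> (V \<omega>) \<partial>M) = (\<integral>\<^sup>+\<omega>. \<phi> (U \<omega>) \<partial>M) * (\<integral>\<^sup>+\<omega>. \<psi> (V \<omega>) \<partial>M)"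
proof -
  have [measurable]: "U \<in> measurable M S" "V \<in> measurable M T"
    using ind by (auto simp: indep_var_eq)
  have "(\<integral>\<^sup>+\<omega>. \<phi> (U \<omega>) * \<psi> (V \<omega>) \<partial>M) = (\<integral>\<^sup>+\<omega>. \<integral>\<^sup>+\<omega>'. \<phi> (U \<omega>') * \<psi> (V \<omega>) \<partial>M \<partial>M)"
    using indep_var_nn_integral[OF ind, of "\<lambda>z. \<phi> (fst z) * \<psi> (snd z)"] by simp
  then show ?thesis
    by (simp add: nn_integral_cmult nn_integral_multc)
qed

lemma component_measurable:
  shows fst_component: "i \<in> A \<Longrightarrow> (\<lambda>z. fst z i) \<in> measurable (PiM A (\<lambda>_. K) \<Otimes>\<^sub>M N) K"
    and snd_component: "i \<in> A \<Longrightarrow> (\<lambda>z. snd z i) \<in> measurable (N \<Otimes>\<^sub>M PiM A (\<lambda>_. K)) K"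
    and fst_snd_component: "i \<in> A \<Longrightarrow> (\<lambda>z. fst (snd z) i) \<in> measurable (N' \<Otimes>\<^sub>M (PiM A (\<lambda>_. K) \<Otimes>\<^sub>M N)) K"
    and snd_snd_component: "i \<in> A \<Longrightarrow> (\<lambda>z. snd (snd z) i) \<in> measurable (N' \<Otimes>\<^sub>M (N \<Otimes>\<^sub>M PiM A (\<lambda>_. K))) K"
  using measurable_component_singleton[of i A "\<lambda>_. K"]
  by (auto intro: measurable_compose[OF measurable_fst] measurable_compose[OF measurable_snd]
      measurable_compose[OF measurable_compose[OF measurable_snd measurable_fst]]
      measurable_compose[OF measurable_compose[OF measurable_snd measurable_snd]])

section \<open>Moments of Poisson counts\<close>

lemma poisson_mass_sums: "(\<lambda>k. r ^ k / fact k * exp (- r)) sums (1::real)"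
proof -
  have "(\<lambda>k. r ^ k / fact k) sums exp r"
    using exp_converges[of r] by (simp add: scaleR_conv_of_real divide_inverse mult.commute)
  from sums_mult2[OF this, of "exp (- r)"] show ?thesis
    by (simp add: exp_minus)
qed

lemma poisson_mean_sums: "(\<lambda>k. real k * (r ^ k / fact k * exp (- r))) sums r"
proof -
  have "(\<lambda>k. r * (r ^ k / fact k * exp (- r))) sums (r * 1)"
    by (intro sums_mult poisson_mass_sums)
  moreover have "r * (r ^ k / fact k * exp (- r)) =
      real (Suc k) * (r ^ Suc k / fact (Suc k) * exp (- r))" for k
    by (simp add: field_simps del: of_nat_Suc)
  ultimately have "(\<lambda>k. real (Suc k) * (r ^ Suc k / fact (Suc k) * exp (- r))) sums r"
    by (simp only: mult_1_right)
  from iffD1[OF sums_Suc_iff this] show ?thesis by simp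
qed

lemma poisson_square_sums: "(\<lambda>k. (real k)\<^sup>2 * (r ^ k / fact k * exp (- r))) sums (r\<^sup>2 + r)"
proof -
  have "(\<lambda>k. r * (real k * (r ^ k / fact k * exp (- r))) + r * (r ^ k / fact k * exp (- r)))
      sums (r * r + r * 1)"
    by (intro sums_add sums_mult poisson_mass_sums poisson_mean_sums)
  moreover have "r * (real k * (r ^ k / fact k * exp (- r))) + r * (r ^ k / fact k * exp (- r)) =
      (real (Suc k))\<^sup>2 * (r ^ Suc k / fact (Suc k) * exp (- r))" for k
  proof -
    have "(real (Suc k))\<^sup>2 * (r ^ Suc k / fact (Suc k) * exp (- r)) =
        r * (real (Suc k) * (r ^ k / fact k * exp (- r)))"
      by (simp add: field_simps power2_eq_square del: of_nat_Suc)
    then show ?thesis by (simp add: distrib_right distrib_left add_divide_distrib)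
  qed
  ultimately have "(\<lambda>k. (real (Suc k))\<^sup>2 * (r ^ Suc k / fact (Suc k) * exp (- r))) sums (r\<^sup>2 + r)"
    by (simp only: mult_1_right power2_eq_square)
  from iffD1[OF sums_Suc_iff this] show ?thesis by simp
qed

text \<open>The probabilities \<open>p k\<close> sum to one, so the values outside the natural numbers, including \<open>\<infinity>\<close>, have
probability zero.\<close>

lemma (in prob_space) nat_valued_distribution:
  fixes N :: "'a \<Rightarrow> ennreal"
  assumes [measurable]: "N \<in> borel_measurable M"
    and p: "\<And>k::nat. prob {\<omega> \<in> space M. N \<omega> = of_nat k} = p k" and "p sums 1"
  shows nat_valued_AE: "AE \<omega> in M. \<exists>k::nat. N \<omega> = of_nat k"
    and nat_valued_nn_integral: "(\<integral>\<^sup>+\<omega>. \<phi> (N \<omega>) \<partial>M) = (\<Sum>k. \<phi> (of_nat k) * ennreal (p k))"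
proof -
  have "prob (\<Union>k. {\<omega> \<in> space M. N \<omega> = of_nat k}) = (\<Sum>k. p k)"
    by (subst p[symmetric], rule sums_unique, intro finite_measure_UNION)
       (auto simp: disjoint_family_on_def)
  also have "\<dots> = 1" using assms(3) by (simp add: sums_iff)
  finally have "AE \<omega> in M. \<omega> \<in> (\<Union>k. {\<omega> \<in> space M. N \<omega> = of_nat k})"
    by (intro AE_prob_1)
  then show AE: "AE \<omega> in M. \<exists>k::nat. N \<omega> = of_nat k" by eventually_elim auto
  have "AE \<omega> in M. \<phi> (N \<omega>) = (\<Sum>k. \<phi> (of_nat k) * indicator {\<omega> \<in> space M. N \<omega> = of_nat k} \<omega>)"
    using AE AE_space
  proof eventually_elim
    case (elim \<omega>)
    then obtain k :: nat where k: "N \<omega> = of_nat k" by auto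
    have "(\<lambda>k. \<phi> (of_nat k) * indicator {\<omega> \<in> space M. N \<omega> = of_nat k} \<omega>) sums
        (\<Sum>j\<in>{k}. \<phi> (of_nat j) * indicator {\<omega> \<in> space M. N \<omega> = of_nat j} \<omega>)"
      using k by (intro sums_finite) (auto simp: indicator_def)
    then show ?case using k elim by (simp add: sums_iff indicator_def)
  qed
  then have "(\<integral>\<^sup>+\<omega>. \<phi> (N \<omega>) \<partial>M) =
      (\<integral>\<^sup>+\<omega>. (\<Sum>k. \<phi> (of_nat k) * indicator {\<omega> \<in> space M. N \<omega> = of_nat k} \<omega>) \<partial>M)"
    by (rule nn_integral_cong_AE)
  also have "\<dots> = (\<Sum>k. \<phi> (of_nat k) * emeasure M {\<omega> \<in> space M. N \<omega> = of_nat k})"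
    by (subst nn_integral_suminf) (auto simp: nn_integral_cmult_indicator)
  finally show "(\<integral>\<^sup>+\<omega>. \<phi> (N \<omega>) \<partial>M) = (\<Sum>k. \<phi> (of_nat k) * ennreal (p k))"
    by (simp add: emeasure_eq_measure p)
qed

lemma point_count_measurable [measurable]:
  fixes Y :: "nat \<Rightarrow> 'w \<Rightarrow> 'a::topological_space"
  assumes "\<And>i. Y i \<in> borel_measurable M" "A \<in> sets borel"
  shows "point_count Y A \<in> borel_measurable M"
proof -
  note [measurable] = assms
  show ?thesis unfolding point_count_def[abs_def] by measurable
qed

lemma homogeneous_ppp_measurable: "homogeneous_ppp M lam X \<Longrightarrow> X i \<in> borel_measurable M"
  by (auto simp: homogeneous_ppp_def)

context prob_space
begin

context
  fixes lam :: real and X :: "nat \<Rightarrow> 'a \<Rightarrow> 'b::euclidean_space"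
  assumes ppp: "homogeneous_ppp M lam X" and lam: "lam > 0"
begin

lemma point_count_mass:
  assumes "A \<in> sets borel" "emeasure lborel A < \<infinity>"
  shows "prob {\<omega> \<in> space M. point_count X A \<omega> = of_nat k} =
    (lam * measure lborel A) ^ k / fact k * exp (- (lam * measure lborel A))"
  using ppp assms unfolding homogeneous_ppp_def by blast

lemma point_count_finite_AE:
  assumes "A \<in> sets borel" "emeasure lborel A < \<infinity>"
  shows "AE \<omega> in M. point_count X A \<omega> < \<infinity>"
  using nat_valued_AE[OF point_count_measurable[OF homogeneous_ppp_measurable[OF ppp]] point_count_mass[OF assms] poisson_mass_sums] assms
  by (auto elim!: eventually_mono simp: ennreal_of_nat_eq_real_of_nat)

lemma point_count_mean:
  assumes A: "A \<in> sets borel" "emeasure lborel A < \<infinity>"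
  shows "(\<integral>\<^sup>+\<omega>. point_count X A \<omega> \<partial>M) = ennreal lam * emeasure lborel A"
proof -
  let ?r = "lam * measure lborel A"
  have r: "ennreal ?r = ennreal lam * emeasure lborel A"
    using A lam by (simp add: ennreal_mult emeasure_eq_ennreal_measure)
  have "(\<integral>\<^sup>+\<omega>. point_count X A \<omega> \<partial>M) = (\<Sum>k. of_nat k * ennreal (?r ^ k / fact k * exp (- ?r)))"
    using A by (intro nat_valued_nn_integral[where \<phi> = "\<lambda>x. x"] point_count_measurable homogeneous_ppp_measurable[OF ppp]
        point_count_mass poisson_mass_sums) auto
  also have "\<dots> = (\<Sum>k. ennreal (real k * (?r ^ k / fact k * exp (- ?r))))"
    by (intro suminf_cong) (simp only: ennreal_mult' ennreal_of_nat_eq_real_of_nat of_nat_0_le_iff)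
  also have "\<dots> = ennreal ?r"
    using lam by (intro suminf_ennreal_eq poisson_mean_sums) auto
  finally show ?thesis by (simp add: r)
qed

lemma point_count_second_moment:
  assumes A: "A \<in> sets borel" "emeasure lborel A < \<infinity>"
  shows "(\<integral>\<^sup>+\<omega>. point_count X A \<omega> * point_count X A \<omega> \<partial>M) =
    (ennreal lam * emeasure lborel A) * (ennreal lam * emeasure lborel A) + ennreal lam * emeasure lborel A"
proof -
  let ?r = "lam * measure lborel A"
  have r: "ennreal ?r = ennreal lam * emeasure lborel A"
    using A lam by (simp add: ennreal_mult emeasure_eq_ennreal_measure)
  have "(\<integral>\<^sup>+\<omega>. point_count X A \<omega> * point_count X A \<omega> \<partial>M) =
      (\<Sum>k. (of_nat k * of_nat k) * ennreal (?r ^ k / fact k * exp (- ?r)))"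
    using A by (intro nat_valued_nn_integral[where \<phi> = "\<lambda>x. x * x"] point_count_measurable homogeneous_ppp_measurable[OF ppp]
        point_count_mass poisson_mass_sums) auto
  also have "\<dots> = (\<Sum>k. ennreal ((real k)\<^sup>2 * (?r ^ k / fact k * exp (- ?r))))"
    by (intro suminf_cong)
       (simp only: ennreal_mult' ennreal_of_nat_eq_real_of_nat power2_eq_square mult.assoc
          of_nat_0_le_iff)
  also have "\<dots> = ennreal (?r\<^sup>2 + ?r)"
    using lam by (intro suminf_ennreal_eq poisson_square_sums) auto
  also have "\<dots> = ennreal ?r * ennreal ?r + ennreal ?r"
    using lam by (simp add: power2_eq_square ennreal_mult)
  finally show ?thesis by (simp only: r)
qed

lemma point_count_disjoint_product:
  assumes A: "A \<in> sets borel" "emeasure lborel A < \<infinity>"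
    and B: "B \<in> sets borel" "emeasure lborel B < \<infinity>" and disj: "A \<inter> B = {}"
  shows "(\<integral>\<^sup>+\<omega>. point_count X A \<omega> * point_count X B \<omega> \<partial>M) =
    (ennreal lam * emeasure lborel A) * (ennreal lam * emeasure lborel B)"
proof -
  define D where "D = (\<lambda>i::nat. if i = 0 then A else B)"
  have "range D \<subseteq> sets borel" "disjoint_family_on D {..<2}"
    using A B disj by (auto simp: D_def disjoint_family_on_def)
  then have "indep_vars (\<lambda>_. borel) (\<lambda>i. point_count X (D i)) {..<2}"
    using ppp unfolding homogeneous_ppp_def by blast
  then have "(\<integral>\<^sup>+\<omega>. (\<Prod>i\<in>{..<2}. point_count X (D i) \<omega>) \<partial>M) =
      (\<Prod>i\<in>{..<2}. \<integral>\<^sup>+\<omega>. point_count X (D i) \<omega> \<partial>M)"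
    by (intro indep_vars_nn_integral) auto
  then show ?thesis
    by (simp add: numeral_2_eq_2 D_def point_count_mean[OF A] point_count_mean[OF B])
qed

lemma point_count_Un: "A \<inter> B = {} \<Longrightarrow> point_count X (A \<union> B) \<omega> = point_count X A \<omega> + point_count X B \<omega>"
  unfolding point_count_def by (subst suminf_add) (auto intro!: suminf_cong simp: indicator_def)

text \<open>Splitting \<open>A\<close> and \<open>B\<close> along \<open>A \<inter> B\<close> leaves products of counts of disjoint sets, which are independent,
and the square of the count of \<open>A \<inter> B\<close>, whose Poisson variance gives the last summand.\<close>

lemma point_count_mixed_moment:
  assumes A: "A \<in> sets borel" "emeasure lborel A < \<infinity>"
    and B: "B \<in> sets borel" "emeasure lborel B < \<infinity>"
  shows "(\<integral>\<^sup>+\<omega>. point_count X A \<omega> * point_count X B \<omega> \<partial>M) =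
    (ennreal lam * emeasure lborel A) * (ennreal lam * emeasure lborel B) + ennreal lam * emeasure lborel (A \<inter> B)"
proof -
  note [measurable] = homogeneous_ppp_measurable[OF ppp]
  have [measurable]: "A \<in> sets borel" "B \<in> sets borel" using A B by auto
  let ?N = "\<lambda>A \<omega>. point_count X A \<omega>" and ?m = "\<lambda>A. ennreal lam * emeasure lborel A"
  define D where "D = A \<inter> B"
  define A1 where "A1 = A - B"
  define B1 where "B1 = B - A"
  have [measurable]: "D \<in> sets borel" "A1 \<in> sets borel" "B1 \<in> sets borel"
    by (auto simp: D_def A1_def B1_def)
  have fin: "emeasure lborel D < \<infinity>" "emeasure lborel A1 < \<infinity>" "emeasure lborel B1 < \<infinity>"
    using le_less_trans[OF emeasure_mono[of D A lborel] A(2)]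
      le_less_trans[OF emeasure_mono[of A1 A lborel] A(2)]
      le_less_trans[OF emeasure_mono[of B1 B lborel] B(2)] A B
    by (auto simp: D_def A1_def B1_def)
  have disj: "A1 \<inter> D = {}" "B1 \<inter> D = {}" "D \<inter> B1 = {}" "A1 \<inter> B1 = {}"
    by (auto simp: D_def A1_def B1_def)
  have un: "A = A1 \<union> D" "B = B1 \<union> D" by (auto simp: D_def A1_def B1_def)
  have mA: "?m A = ?m A1 + ?m D" and mB: "?m B = ?m B1 + ?m D"
    using disj by (simp_all add: un(1) un(2) plus_emeasure[symmetric] distrib_left)
  have "(\<integral>\<^sup>+\<omega>. ?N A \<omega> * ?N B \<omega> \<partial>M) =
      (\<integral>\<^sup>+\<omega>. (?N A1 \<omega> * ?N B1 \<omega> + ?N A1 \<omega> * ?N D \<omega>) + (?N D \<omega> * ?N B1 \<omega> + ?N D \<omega> * ?N D \<omega>) \<partial>M)"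
    using disj by (intro nn_integral_cong) (simp add: un point_count_Un algebra_simps)
  also have "\<dots> = (?m A1 * ?m B1 + ?m A1 * ?m D) + (?m D * ?m B1 + (?m D * ?m D + ?m D))"
    using fin disj
    by (simp add: nn_integral_add point_count_disjoint_product point_count_second_moment)
  also have "\<dots> = ?m A * ?m B + ?m D"
    by (simp add: mA mB algebra_simps)
  finally show ?thesis by (simp add: D_def)
qed

end

end

section \<open>Campbell formulas conditionally on the counts of an independent process\<close>

text \<open>The expected total weight of the indices \<open>i\<close> with \<open>(W i, Z i)\<close> in a given set is a measure of this set. If
it agrees with the product of \<open>S\<close> and \<open>T\<close> on rectangles with sides of finite measure, then it does so on all
rectangles, by exhaustion, and hence everywhere. Both Campbell formulas are instances; there the
weights select an event and the pairs of distinct indices, and \<open>W\<close> may be the identity on the sample space.\<close>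

lemma nn_integral_random_points:
  fixes W :: "'i::countable \<Rightarrow> 'a \<Rightarrow> 's" and Z :: "'i \<Rightarrow> 'a \<Rightarrow> 't"
  assumes "sigma_finite_measure M" and S: "sigma_finite_measure S" and T: "sigma_finite_measure T"
    and [measurable]: "\<And>i. w i \<in> borel_measurable M" "\<And>i. W i \<in> measurable M S"
      "\<And>i. Z i \<in> measurable M T"
    and rect: "\<And>A B. A \<in> sets S \<Longrightarrow> B \<in> sets T \<Longrightarrow> emeasure S A < \<infinity> \<Longrightarrow> emeasure T B < \<infinity> \<Longrightarrow>
      (\<integral>\<^sup>+\<omega>. \<integral>\<^sup>+i. w i \<omega> * (indicator A (W i \<omega>) * indicator B (Z i \<omega>)) \<partial>count_space UNIV \<partial>M)
        = emeasure S A * emeasure T B"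
    and [measurable]: "F \<in> borel_measurable (S \<Otimes>\<^sub>M T)"
  shows "(\<integral>\<^sup>+\<omega>. \<integral>\<^sup>+i. w i \<omega> * F (W i \<omega>, Z i \<omega>) \<partial>count_space UNIV \<partial>M) =
    (\<integral>\<^sup>+x. \<integral>\<^sup>+y. F (x, y) \<partial>T \<partial>S)"
proof -
  interpret M: sigma_finite_measure M by fact
  interpret S: sigma_finite_measure S by fact
  interpret T: sigma_finite_measure T by fact
  interpret I: sigma_finite_measure "count_space (UNIV :: 'i set)"
    by (rule sigma_finite_measure_count_space)
  interpret P: pair_sigma_finite M "count_space (UNIV :: 'i set)" ..
  interpret Q: pair_sigma_finite S T ..
  let ?C = "count_space (UNIV :: 'i set)"
  have w [measurable]: "(\<lambda>(\<omega>, i). w i \<omega>) \<in> borel_measurable (M \<Otimes>\<^sub>M ?C)"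
    and WZ [measurable]: "(\<lambda>(\<omega>, i). (W i \<omega>, Z i \<omega>)) \<in> measurable (M \<Otimes>\<^sub>M ?C) (S \<Otimes>\<^sub>M T)"
    unfolding case_prod_beta'
    using measurable_compose_countable'[where I = UNIV and g = snd and N = borel and f = "\<lambda>i p. w i (fst p)" and M = "M \<Otimes>\<^sub>M ?C"]
      measurable_compose_countable'[where I = UNIV and g = snd and N = "S \<Otimes>\<^sub>M T" and f = "\<lambda>i p. (W i (fst p), Z i (fst p))" and M = "M \<Otimes>\<^sub>M ?C"]
    by simp_all
  define K where "K = distr (density (M \<Otimes>\<^sub>M ?C) (\<lambda>(\<omega>, i). w i \<omega>)) (S \<Otimes>\<^sub>M T) (\<lambda>(\<omega>, i). (W i \<omega>, Z i \<omega>))"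
  have int: "(\<integral>\<^sup>+z. G z \<partial>K) = (\<integral>\<^sup>+\<omega>. \<integral>\<^sup>+i. w i \<omega> * G (W i \<omega>, Z i \<omega>) \<partial>?C \<partial>M)"
    if [measurable]: "G \<in> borel_measurable (S \<Otimes>\<^sub>M T)" for G
  proof -
    have [measurable]: "(\<lambda>p. G (W (snd p) (fst p), Z (snd p) (fst p))) \<in> borel_measurable (M \<Otimes>\<^sub>M ?C)"
      using measurable_compose[OF WZ that] by (simp add: case_prod_beta')
    have [measurable]: "(\<lambda>p. w (snd p) (fst p)) \<in> borel_measurable (M \<Otimes>\<^sub>M ?C)"
      using w by (simp add: case_prod_beta')
    have "(\<integral>\<^sup>+z. G z \<partial>K) = (\<integral>\<^sup>+p. w (snd p) (fst p) * G (W (snd p) (fst p), Z (snd p) (fst p)) \<partial>(M \<Otimes>\<^sub>M ?C))"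
      unfolding K_def using WZ that
      by (simp add: nn_integral_distr nn_integral_density case_prod_beta')
    also have "\<dots> = (\<integral>\<^sup>+\<omega>. \<integral>\<^sup>+i. w i \<omega> * G (W i \<omega>, Z i \<omega>) \<partial>?C \<partial>M)"
      by (subst I.nn_integral_fst[symmetric]) simp_all
    finally show ?thesis .
  qed
  have ind: "indicator (A \<times> B) (a, b) = (indicator A a * indicator B b :: ennreal)" for A B a b
    by (auto simp: indicator_def)
  have "S \<Otimes>\<^sub>M T = K"
  proof (rule pair_measure_eqI[OF S T])
    show "sets (S \<Otimes>\<^sub>M T) = sets K" by (simp add: K_def)
    fix A B assume [measurable]: "A \<in> sets S" "B \<in> sets T"
    obtain D :: "nat \<Rightarrow> 's set" where D: "range D \<subseteq> sets S" "(\<Union>i. D i) = space S" "\<And>i. emeasure S (D i) \<noteq> \<infinity>"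
      "disjoint_family D"
      by (rule S.sigma_finite_disjoint) blast
    obtain E :: "nat \<Rightarrow> 't set" where E: "range E \<subseteq> sets T" "(\<Union>i. E i) = space T" "\<And>i. emeasure T (E i) \<noteq> \<infinity>"
      "disjoint_family E"
      by (rule T.sigma_finite_disjoint) blast
    have [measurable]: "D i \<in> sets S" "E i \<in> sets T" for i using D E by auto
    have part: "emeasure N U = (\<Sum>i. emeasure N (U \<inter> V i))"
      if "U \<in> sets N" "range V \<subseteq> sets N" "disjoint_family V" "(\<Union>i. V i) \<inter> U = U" for N :: "'z measure" and U and V :: "nat \<Rightarrow> 'z set"
    proof -
      have "(\<Sum>i. emeasure N (U \<inter> V i)) = emeasure N (\<Union>i. U \<inter> V i)"
        using that by (intro suminf_emeasure) (auto simp: disjoint_family_on_def)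
      also have "(\<Union>i. U \<inter> V i) = U" using that by auto
      finally show ?thesis by simp
    qed
    have fin: "emeasure S (A \<inter> D i) < \<infinity>" "emeasure T (B \<inter> E i) < \<infinity>" for i
      using D(3)[of i] E(3)[of i] emeasure_mono[of "A \<inter> D i" "D i" S] emeasure_mono[of "B \<inter> E i" "E i" T]
      by (auto simp: less_top[symmetric] top_unique)
    have AB: "A \<subseteq> space S" "B \<subseteq> space T" by (intro sets.sets_into_space; fact)+
    have rectK: "emeasure K ((A \<inter> D i) \<times> (B \<inter> E j)) = emeasure S (A \<inter> D i) * emeasure T (B \<inter> E j)" for i j
    proof -
      have "emeasure K ((A \<inter> D i) \<times> (B \<inter> E j)) = (\<integral>\<^sup>+z. indicator ((A \<inter> D i) \<times> (B \<inter> E j)) z \<partial>K)"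
        by (subst nn_integral_indicator) (auto simp: K_def)
      also have "\<dots> = emeasure S (A \<inter> D i) * emeasure T (B \<inter> E j)"
        by (subst int) (auto simp: ind rect[OF _ _ fin])
      finally show ?thesis .
    qed
    have "emeasure S A * emeasure T B = (\<Sum>i. emeasure S (A \<inter> D i)) * (\<Sum>j. emeasure T (B \<inter> E j))"
      using D E AB by (subst part[of A S D], simp_all, subst part[of B T E]) auto
    also have "\<dots> = (\<Sum>i. \<Sum>j. emeasure K ((A \<inter> D i) \<times> (B \<inter> E j)))"
      by (simp add: rectK)
    also have "\<dots> = (\<Sum>i. emeasure K ((A \<inter> D i) \<times> B))"
    proof (intro suminf_cong)
      fix i
      have "(\<Sum>j. emeasure K ((A \<inter> D i) \<times> (B \<inter> E j))) = emeasure K (\<Union>j. (A \<inter> D i) \<times> (B \<inter> E j))"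
        using E(4) by (intro suminf_emeasure) (simp add: K_def image_subset_iff, unfold disjoint_family_on_def, blast)
      also have "(\<Union>j. (A \<inter> D i) \<times> (B \<inter> E j)) = (A \<inter> D i) \<times> B" using E(2) AB by blast
      finally show "(\<Sum>j. emeasure K ((A \<inter> D i) \<times> (B \<inter> E j))) = emeasure K ((A \<inter> D i) \<times> B)" .
    qed
    also have "\<dots> = emeasure K (\<Union>i. (A \<inter> D i) \<times> B)"
      using D(4) by (intro suminf_emeasure) (simp add: K_def image_subset_iff, unfold disjoint_family_on_def, blast)
    also have "(\<Union>i. (A \<inter> D i) \<times> B) = A \<times> B" using D(2) AB by blast
    finally show "emeasure S A * emeasure T B = emeasure K (A \<times> B)" .
  qed
  with int[of F] T.nn_integral_fst[of F S] show ?thesis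
    using \<open>F \<in> borel_measurable (S \<Otimes>\<^sub>M T)\<close> by simp
qed

definition intensity :: "real \<Rightarrow> 'a::euclidean_space measure" where
  "intensity lam = density lborel (\<lambda>_. ennreal lam)"

lemma sets_intensity [measurable_cong, simp]: "sets (intensity lam) = sets borel"
  by (simp add: intensity_def)

lemma space_intensity [simp]: "space (intensity lam) = UNIV"
  by (simp add: intensity_def)

lemma emeasure_intensity: "A \<in> sets borel \<Longrightarrow> emeasure (intensity lam) A = ennreal lam * emeasure lborel A"
  by (simp add: intensity_def emeasure_density_const)

lemma nn_integral_intensity:
  "f \<in> borel_measurable borel \<Longrightarrow> (\<integral>\<^sup>+x. f x \<partial>intensity lam) = ennreal lam * (\<integral>\<^sup>+x. f x \<partial>lborel)"
  by (simp add: intensity_def nn_integral_density nn_integral_cmult)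

lemma sigma_finite_intensity: "sigma_finite_measure (intensity lam)"
  unfolding intensity_def
  by (subst sigma_finite_measure.sigma_finite_iff_density_finite[OF lborel.sigma_finite_measure_axioms]) auto

lemma emeasure_intensity_finiteD:
  assumes "lam > 0" "A \<in> sets borel" "emeasure (intensity lam) A < \<infinity>"
  shows "emeasure lborel A < \<infinity>"
  using assms by (auto simp: emeasure_intensity ennreal_mult_less_top)

text \<open>The probability space restricted to the events that depend only on the counting variables of \<open>Y\<close>.
A function measurable on this space is a functional of the point process, as opposed to one of
its enumeration.\<close>

definition count_events :: "'w measure \<Rightarrow> (nat \<Rightarrow> 'w \<Rightarrow> 'a::topological_space) \<Rightarrow> 'w measure" where
  "count_events M Y = distr M (vimage_algebra (space M) (\<lambda>\<omega>. \<lambda>A\<in>sets borel. point_count Y A \<omega>)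
     (PiM (sets borel) (\<lambda>_. borel))) (\<lambda>\<omega>. \<omega>)"

lemma space_count_events [simp]: "space (count_events M Y) = space M"
  by (simp add: count_events_def)

lemma counts_measurable:
  assumes "\<And>i. Y i \<in> borel_measurable M"
  shows "(\<lambda>\<omega>. \<lambda>A\<in>sets borel. point_count Y A \<omega>) \<in> measurable M (PiM (sets borel) (\<lambda>_. borel))"
  using assms by (intro measurable_restrict point_count_measurable)

lemma id_measurable_count_events:
  assumes "\<And>i. Y i \<in> borel_measurable M"
  shows "(\<lambda>\<omega>. \<omega>) \<in> measurable M (count_events M Y)"
  using counts_measurable[OF assms] unfolding count_events_def
  by (auto intro!: measurable_vimage_algebra2)

lemma nn_integral_count_events:
  assumes "\<And>i. Y i \<in> borel_measurable M" "f \<in> borel_measurable (count_events M Y)"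
  shows "(\<integral>\<^sup>+\<omega>. f \<omega> \<partial>count_events M Y) = (\<integral>\<^sup>+\<omega>. f \<omega> \<partial>M)"
  using id_measurable_count_events[OF assms(1)] assms(2)
  unfolding count_events_def by (subst nn_integral_distr) auto

lemma sets_count_eventsD:
  assumes "\<And>i. Y i \<in> borel_measurable M" "A \<in> sets (count_events M Y)"
  shows "A \<in> sets M"
  using measurable_sets[OF id_measurable_count_events[of Y M] assms(2)] assms(1) sets.sets_into_space[OF assms(2)]
  by (simp add: Int_absorb2)

lemma emeasure_count_events:
  assumes Y: "\<And>i. Y i \<in> borel_measurable M" and A: "A \<in> sets (count_events M Y)"
  shows "emeasure (count_events M Y) A = emeasure M A"
  using nn_integral_count_events[where Y = Y and M = M, OF Y, of "indicator A"] A
    sets_count_eventsD[OF Y A] by simp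

lemma point_count_count_events [measurable]:
  "A \<in> sets borel \<Longrightarrow> point_count Y A \<in> borel_measurable (count_events M Y)"
proof -
  assume A: "A \<in> sets borel"
  have "(\<lambda>\<omega>. (\<lambda>A\<in>sets borel. point_count Y A \<omega>) A) \<in> borel_measurable (count_events M Y)"
    unfolding count_events_def measurable_distr_eq1
    by (rule measurable_compose[OF measurable_vimage_algebra1 measurable_component_singleton])
       (use A in \<open>auto simp: space_PiM\<close>)
  then show ?thesis using A by simp
qed

context prob_space
begin

context
  fixes lam :: real and X :: "nat \<Rightarrow> 'a \<Rightarrow> 'b::euclidean_space" and Y :: "nat \<Rightarrow> 'a \<Rightarrow> 'b"
  assumes ppp: "homogeneous_ppp M lam X" and lam: "lam > 0"
    and Y: "\<And>i. Y i \<in> borel_measurable M" and ind: "indep_point_processes M Y X"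
begin

lemma count_events_prob_space: "prob_space (count_events M Y)"
  using id_measurable_count_events[OF Y] unfolding count_events_def
  by (intro prob_space_distr) auto

text \<open>The form in which independence of the two point processes is used: \<open>A\<close> is an event of the counts of
\<open>Y\<close>, and the other factor is a functional of the counts of \<open>X\<close>.\<close>

lemma count_events_factor:
  assumes A: "A \<in> sets (count_events M Y)"
    and \<psi>: "\<psi> \<in> borel_measurable (PiM (sets borel) (\<lambda>_. borel))"
  shows "(\<integral>\<^sup>+\<omega>. indicator A \<omega> * \<psi> (\<lambda>B\<in>sets borel. point_count X B \<omega>) \<partial>M) =
    emeasure M A * (\<integral>\<^sup>+\<omega>. \<psi> (\<lambda>B\<in>sets borel. point_count X B \<omega>) \<partial>M)"
proof -
  let ?N = "\<lambda>\<omega>. \<lambda>A\<in>sets borel. point_count Y A \<omega>"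
  obtain A' where A': "A' \<in> sets (PiM (sets borel) (\<lambda>_. borel))" "A = ?N -` A' \<inter> space M"
  proof -
    have "?N \<in> space M \<rightarrow> space (PiM (sets borel) (\<lambda>_. borel))"
      using measurable_space[OF counts_measurable[where Y = Y and M = M, OF Y]] by blast
    from sets_vimage_algebra2[OF this] A that show thesis
      unfolding count_events_def by auto
  qed
  have "A \<in> sets M"
    using A' counts_measurable[OF Y] by (auto intro: measurable_sets)
  have eq: "indicator A \<omega> = (indicator A' (?N \<omega>) :: ennreal)" if "\<omega> \<in> space M" for \<omega>
    using A' that by (auto simp: indicator_def)
  have "(\<integral>\<^sup>+\<omega>. indicator A' (?N \<omega>) * \<psi> (\<lambda>B\<in>sets borel. point_count X B \<omega>) \<partial>M) =
    (\<integral>\<^sup>+\<omega>. indicator A' (?N \<omega>) \<partial>M) * (\<integral>\<^sup>+\<omega>. \<psi> (\<lambda>B\<in>sets borel. point_count X B \<omega>) \<partial>M)"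
    using ind A' \<psi> unfolding indep_point_processes_def
    by (intro indep_var_nn_integral_mult[where S = "PiM (sets borel) (\<lambda>_. borel)"
        and T = "PiM (sets borel) (\<lambda>_. borel)" and \<phi> = "indicator A'" and \<psi> = \<psi>]) auto
  moreover have "(\<integral>\<^sup>+\<omega>. indicator A' (?N \<omega>) \<partial>M) = emeasure M A"
    using nn_integral_indicator[OF \<open>A \<in> sets M\<close>] by (simp add: eq cong: nn_integral_cong)
  ultimately show ?thesis by (simp add: eq cong: nn_integral_cong)
qed

text \<open>Adding the diagonal \<open>j = k\<close> completes the double sum to the product of the counts of \<open>B\<close> and \<open>C\<close>, and
the diagonal itself is the count of \<open>B \<inter> C\<close>. Its expectation is exactly the excess of the mixed
moment of Poisson counts over the product of their means.\<close>

lemma pair_count_on_event: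
  assumes A: "A \<in> sets (count_events M Y)"
    and B: "B \<in> sets borel" "emeasure lborel B < \<infinity>" and C: "C \<in> sets borel" "emeasure lborel C < \<infinity>"
  shows "(\<integral>\<^sup>+\<omega>. indicator A \<omega> * (\<Sum>j k. of_bool (j \<noteq> k) * (indicator B (X j \<omega>) * indicator C (X k \<omega>))) \<partial>M) =
    emeasure M A * (emeasure (intensity lam) B * emeasure (intensity lam) C)"
    (is "(\<integral>\<^sup>+\<omega>. indicator A \<omega> * ?S \<omega> \<partial>M) = _")
proof -
  have [measurable]: "A \<in> sets M"
    using Y A by (rule sets_count_eventsD)
  note [measurable] = homogeneous_ppp_measurable[OF ppp]
  have [measurable]: "B \<in> sets borel" "C \<in> sets borel" using B C by auto
  have split: "?S \<omega> + point_count X (B \<inter> C) \<omega> = point_count X B \<omega> * point_count X C \<omega>" for \<omega>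
  proof -
    have diag: "indicator (B \<inter> C) (X j \<omega>) =
        (\<Sum>k. of_bool (j = k) * (indicator B (X j \<omega>) * indicator C (X k \<omega>) :: ennreal))" for j
      by (subst suminf_finite[of "{j}"]) (auto simp: indicator_def)
    have "?S \<omega> + point_count X (B \<inter> C) \<omega> =
       (\<Sum>j k. of_bool (j \<noteq> k) * (indicator B (X j \<omega>) * indicator C (X k \<omega>)) +
             of_bool (j = k) * (indicator B (X j \<omega>) * indicator C (X k \<omega>)))"
      unfolding point_count_def diag by (simp add: suminf_add)
    also have "\<dots> = (\<Sum>j k. indicator B (X j \<omega>) * indicator C (X k \<omega>))"
      by (intro suminf_cong) auto
    also have "\<dots> = point_count X B \<omega> * point_count X C \<omega>"
      by (simp add: point_count_def)
    finally show ?thesis .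
  qed
  have BC: "emeasure lborel (B \<inter> C) < \<infinity>"
    using le_less_trans[OF emeasure_mono[of "B \<inter> C" B lborel] B(2)] by auto
  have "(\<integral>\<^sup>+\<omega>. indicator A \<omega> * (point_count X B \<omega> * point_count X C \<omega>) \<partial>M) =
     emeasure M A * (\<integral>\<^sup>+\<omega>. point_count X B \<omega> * point_count X C \<omega> \<partial>M)"
    using count_events_factor[OF A, of "\<lambda>n. n B * n C"] B C by simp
  also have "\<dots> = emeasure M A * (emeasure (intensity lam) B * emeasure (intensity lam) C)
      + emeasure M A * emeasure (intensity lam) (B \<inter> C)"
    using point_count_mixed_moment[OF ppp lam B C] B C by (simp add: emeasure_intensity distrib_left)
  finally have 1: "(\<integral>\<^sup>+\<omega>. indicator A \<omega> * (point_count X B \<omega> * point_count X C \<omega>) \<partial>M) = \<dots>" .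
  have 2: "(\<integral>\<^sup>+\<omega>. indicator A \<omega> * point_count X (B \<inter> C) \<omega> \<partial>M) = emeasure M A * emeasure (intensity lam) (B \<inter> C)"
    using count_events_factor[OF A, of "\<lambda>n. n (B \<inter> C)"] B C point_count_mean[OF ppp lam _ BC]
    by (simp add: emeasure_intensity)
  have [measurable]: "(\<lambda>\<omega>. ?S \<omega>) \<in> borel_measurable M" by measurable
  have "(\<integral>\<^sup>+\<omega>. indicator A \<omega> * ?S \<omega> \<partial>M) + (\<integral>\<^sup>+\<omega>. indicator A \<omega> * point_count X (B \<inter> C) \<omega> \<partial>M) =
    (\<integral>\<^sup>+\<omega>. indicator A \<omega> * (point_count X B \<omega> * point_count X C \<omega>) \<partial>M)"
    by (subst nn_integral_add[symmetric]) (auto simp: split[symmetric] distrib_left)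
  \<comment> \<open>finiteness allows the diagonal to be cancelled from both sides\<close>
  moreover have "emeasure M A * emeasure (intensity lam) (B \<inter> C) \<noteq> \<top>"
    using BC B C by (auto simp: emeasure_intensity ennreal_mult_eq_top_iff emeasure_eq_measure)
  ultimately show ?thesis unfolding 1 2 by (simp add: ennreal_add_left_cancel add.commute)
qed

lemma count_on_event:
  assumes A: "A \<in> sets (count_events M Y)" and B: "B \<in> sets borel" "emeasure lborel B < \<infinity>"
  shows "(\<integral>\<^sup>+\<omega>. indicator A \<omega> * (\<Sum>j. indicator B (X j \<omega>)) \<partial>M) = emeasure M A * emeasure (intensity lam) B"
  using count_events_factor[OF A, of "\<lambda>n. n B"] B point_count_mean[OF ppp lam B]
  by (simp add: emeasure_intensity point_count_def)

text \<open>The integrand may depend on the independent process \<open>Y\<close> as well as on the location of the point of \<open>X\<close>.\<close>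

lemma campbell:
  fixes F :: "'a \<times> 'b \<Rightarrow> ennreal"
  assumes F: "F \<in> borel_measurable (count_events M Y \<Otimes>\<^sub>M borel)"
  shows "(\<integral>\<^sup>+\<omega>. (\<Sum>j. F (\<omega>, X j \<omega>)) \<partial>M) = (\<integral>\<^sup>+\<omega>. \<integral>\<^sup>+x. F (\<omega>, x) \<partial>intensity lam \<partial>count_events M Y)"
proof -
  interpret C: prob_space "count_events M Y" by (rule count_events_prob_space)
  note [measurable] = id_measurable_count_events[OF Y] homogeneous_ppp_measurable[OF ppp]
  have "(\<integral>\<^sup>+\<omega>. \<integral>\<^sup>+j. 1 * F (\<omega>, X j \<omega>) \<partial>count_space UNIV \<partial>M) =
      (\<integral>\<^sup>+\<omega>. \<integral>\<^sup>+x. F (\<omega>, x) \<partial>intensity lam \<partial>count_events M Y)"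
  proof (rule nn_integral_random_points)
    fix A and B :: "'b set" assume AB: "A \<in> sets (count_events M Y)" "B \<in> sets (intensity lam)"
       "emeasure (intensity lam) B < \<infinity>"
    then have B: "B \<in> sets borel" "emeasure lborel B < \<infinity>"
      using emeasure_intensity_finiteD[OF lam] by auto
    have "(\<integral>\<^sup>+\<omega>. \<integral>\<^sup>+j. 1 * (indicator A \<omega> * indicator B (X j \<omega>)) \<partial>count_space UNIV \<partial>M) =
        (\<integral>\<^sup>+\<omega>. indicator A \<omega> * (\<Sum>j. indicator B (X j \<omega>)) \<partial>M)"
      by (simp add: nn_integral_count_space_nat)
    then show "(\<integral>\<^sup>+\<omega>. \<integral>\<^sup>+j. 1 * (indicator A \<omega> * indicator B (X j \<omega>)) \<partial>count_space UNIV \<partial>M) =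
        emeasure (count_events M Y) A * emeasure (intensity lam) B"
      using count_on_event[OF AB(1) B] AB by (simp add: emeasure_count_events[OF Y])
  qed (use F in \<open>auto intro: sigma_finite_intensity sigma_finite_measure_axioms C.sigma_finite_measure_axioms\<close>)
  then show ?thesis by (simp add: nn_integral_count_space_nat)
qed

text \<open>The rectangle principle is applied twice. For a fixed event of the counts of \<open>Y\<close> it identifies the pair
measure of \<open>X\<close> on the product space, and a second application adds the dependence on \<open>Y\<close>.\<close>

lemma campbell_second_order:
  fixes F :: "'a \<times> 'b \<times> 'b \<Rightarrow> ennreal"
  assumes F: "F \<in> borel_measurable (count_events M Y \<Otimes>\<^sub>M (borel \<Otimes>\<^sub>M borel))"
  shows "(\<integral>\<^sup>+\<omega>. (\<Sum>j k. of_bool (j \<noteq> k) * F (\<omega>, X j \<omega>, X k \<omega>)) \<partial>M) =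
    (\<integral>\<^sup>+\<omega>. \<integral>\<^sup>+x. \<integral>\<^sup>+x'. F (\<omega>, x, x') \<partial>intensity lam \<partial>intensity lam \<partial>count_events M Y)"
proof -
  interpret C: prob_space "count_events M Y" by (rule count_events_prob_space)
  note [measurable] = id_measurable_count_events[OF Y] homogeneous_ppp_measurable[OF ppp]
  let ?\<nu> = "intensity lam :: 'b measure"
  interpret I: sigma_finite_measure ?\<nu> by (rule sigma_finite_intensity)
  interpret II: pair_sigma_finite ?\<nu> ?\<nu> ..
  have sum2: "(\<integral>\<^sup>+p. (case p of (j, k) \<Rightarrow> u j k) \<partial>count_space (UNIV :: (nat \<times> nat) set)) = (\<Sum>j k. u j k :: ennreal)" for u
    by (subst nn_integral_fst_count_space[symmetric]) (simp add: nn_integral_count_space_nat)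
  have pair: "(\<integral>\<^sup>+\<omega>. indicator A \<omega> * (\<Sum>j k. of_bool (j \<noteq> k) * indicator D (X j \<omega>, X k \<omega>)) \<partial>M) =
      emeasure M A * emeasure (?\<nu> \<Otimes>\<^sub>M ?\<nu>) D"
    if A: "A \<in> sets (count_events M Y)" and D [measurable]: "D \<in> sets (?\<nu> \<Otimes>\<^sub>M ?\<nu>)" for A D
  proof -
    have AM [measurable]: "A \<in> sets M"
      using Y A by (rule sets_count_eventsD)
    have DB: "D \<in> sets (borel \<Otimes>\<^sub>M borel)"
      using D by (simp cong: sets_pair_measure_cong)
    \<comment> \<open>the probability of the event is absorbed into the measure of the first point\<close>
    define \<nu>' where "\<nu>' = density ?\<nu> (\<lambda>_. emeasure M A)"
    have s\<nu>' [measurable_cong, simp]: "sets \<nu>' = sets borel" by (simp add: \<nu>'_def)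
    have "sigma_finite_measure \<nu>'"
      unfolding \<nu>'_def by (subst I.sigma_finite_iff_density_finite) (auto simp: emeasure_eq_measure)
    have e: "(\<integral>\<^sup>+\<omega>. \<integral>\<^sup>+p. (indicator A \<omega> * of_bool (fst p \<noteq> snd p)) * G (X (fst p) \<omega>, X (snd p) \<omega>)
           \<partial>count_space UNIV \<partial>M) =
        (\<integral>\<^sup>+\<omega>. indicator A \<omega> * (\<Sum>j k. of_bool (j \<noteq> k) * G (X j \<omega>, X k \<omega>)) \<partial>M)" for G
      by (simp add: sum2[symmetric] case_prod_beta' nn_integral_cmult mult.assoc)
    have "(\<integral>\<^sup>+\<omega>. \<integral>\<^sup>+p. (indicator A \<omega> * of_bool (fst p \<noteq> snd p)) * indicator D (X (fst p) \<omega>, X (snd p) \<omega>)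
        \<partial>count_space UNIV \<partial>M) = (\<integral>\<^sup>+x. \<integral>\<^sup>+x'. indicator D (x, x') \<partial>?\<nu> \<partial>\<nu>')"
    proof (rule nn_integral_random_points)
      fix B C :: "'b set"
      assume B: "B \<in> sets \<nu>'" "emeasure \<nu>' B < \<infinity>" and C: "C \<in> sets ?\<nu>" "emeasure ?\<nu> C < \<infinity>"
      have C': "C \<in> sets borel" "emeasure lborel C < \<infinity>"
        using C emeasure_intensity_finiteD[OF lam] by auto
      have eB: "emeasure \<nu>' B = emeasure M A * emeasure ?\<nu> B"
        using B by (simp add: \<nu>'_def emeasure_density_const)
      have "(\<integral>\<^sup>+\<omega>. indicator A \<omega> * (\<Sum>j k. of_bool (j \<noteq> k) * (indicator B (X j \<omega>) * indicator C (X k \<omega>))) \<partial>M)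
          = emeasure M A * (emeasure ?\<nu> B * emeasure ?\<nu> C)"
      \<comment> \<open>for a null event, finite measure of \<open>B\<close> under \<open>\<nu>'\<close> says nothing about \<open>B\<close>\<close>
      proof (cases "emeasure M A = 0")
        case True
        then have "AE \<omega> in M. \<omega> \<notin> A" by (intro AE_not_in) (auto simp: null_sets_def)
        then have "(\<integral>\<^sup>+\<omega>. indicator A \<omega> * (\<Sum>j k. of_bool (j \<noteq> k) * (indicator B (X j \<omega>) * indicator C (X k \<omega>))) \<partial>M)
          = (\<integral>\<^sup>+\<omega>. 0 \<partial>M)" by (intro nn_integral_cong_AE) auto
        then show ?thesis using True by simp
      next
        case False
        then have "emeasure ?\<nu> B < \<infinity>"
          using B(2) by (auto simp: eB ennreal_mult_less_top)
        then have "B \<in> sets borel" "emeasure lborel B < \<infinity>"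
          using B emeasure_intensity_finiteD[OF lam, of B] by auto
        then show ?thesis using pair_count_on_event[OF A _ _ C'] by simp
      qed
      then show "(\<integral>\<^sup>+\<omega>. \<integral>\<^sup>+p. (indicator A \<omega> * of_bool (fst p \<noteq> snd p)) *
           (indicator B (X (fst p) \<omega>) * indicator C (X (snd p) \<omega>)) \<partial>count_space UNIV \<partial>M) =
           emeasure \<nu>' B * emeasure ?\<nu> C"
        using e[of "\<lambda>(x, y). indicator B x * indicator C y"] by (simp add: eB mult.assoc)
    next
      show "sigma_finite_measure M" by unfold_locales
      show "sigma_finite_measure \<nu>'" by fact
    qed (use DB in \<open>auto intro: I.sigma_finite_measure_axioms cong: measurable_cong_sets sets_pair_measure_cong\<close>)
    also have "\<dots> = emeasure M A * (\<integral>\<^sup>+x. \<integral>\<^sup>+x'. indicator D (x, x') \<partial>?\<nu> \<partial>?\<nu>)"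
      unfolding \<nu>'_def by (subst nn_integral_density) (auto simp: nn_integral_cmult)
    also have "(\<integral>\<^sup>+x. \<integral>\<^sup>+x'. indicator D (x, x') \<partial>?\<nu> \<partial>?\<nu>) = emeasure (?\<nu> \<Otimes>\<^sub>M ?\<nu>) D"
      by (subst I.nn_integral_fst) (use D in auto)
    finally show ?thesis unfolding e .
  qed
  have "(\<integral>\<^sup>+\<omega>. \<integral>\<^sup>+p. of_bool (fst p \<noteq> snd p) * F (\<omega>, X (fst p) \<omega>, X (snd p) \<omega>) \<partial>count_space UNIV \<partial>M) =
     (\<integral>\<^sup>+\<omega>. \<integral>\<^sup>+z. F (\<omega>, z) \<partial>(?\<nu> \<Otimes>\<^sub>M ?\<nu>) \<partial>count_events M Y)"
  proof (rule nn_integral_random_points)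
    fix A and D :: "('b \<times> 'b) set"
    assume AD: "A \<in> sets (count_events M Y)" "D \<in> sets (?\<nu> \<Otimes>\<^sub>M ?\<nu>)"
    have "(\<integral>\<^sup>+\<omega>. \<integral>\<^sup>+p. of_bool (fst p \<noteq> snd p) * (indicator A \<omega> * indicator D (X (fst p) \<omega>, X (snd p) \<omega>)) \<partial>count_space UNIV \<partial>M)
       = (\<integral>\<^sup>+\<omega>. indicator A \<omega> * (\<Sum>j k. of_bool (j \<noteq> k) * indicator D (X j \<omega>, X k \<omega>)) \<partial>M)"
      by (simp add: sum2[symmetric] case_prod_beta' nn_integral_cmult[symmetric] mult_ac)
    then show "(\<integral>\<^sup>+\<omega>. \<integral>\<^sup>+p. of_bool (fst p \<noteq> snd p) * (indicator A \<omega> * indicator D (X (fst p) \<omega>, X (snd p) \<omega>)) \<partial>count_space UNIV \<partial>M)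
       = emeasure (count_events M Y) A * emeasure (?\<nu> \<Otimes>\<^sub>M ?\<nu>) D"
      using pair[OF AD] AD by (simp add: emeasure_count_events[OF Y])
  next
    show "sigma_finite_measure M" "sigma_finite_measure (count_events M Y)"
      "sigma_finite_measure (?\<nu> \<Otimes>\<^sub>M ?\<nu>)" by unfold_locales
    show "F \<in> borel_measurable (count_events M Y \<Otimes>\<^sub>M (?\<nu> \<Otimes>\<^sub>M ?\<nu>))"
      using F by (simp cong: measurable_cong_sets sets_pair_measure_cong)
  qed auto
  moreover have "(\<integral>\<^sup>+z. F (\<omega>, z) \<partial>(?\<nu> \<Otimes>\<^sub>M ?\<nu>)) = (\<integral>\<^sup>+x. \<integral>\<^sup>+x'. F (\<omega>, x, x') \<partial>?\<nu> \<partial>?\<nu>)"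
    if "\<omega> \<in> space M" for \<omega>
    using measurable_compose_Pair1[OF _ F] that
    by (subst I.nn_integral_fst[symmetric]) (auto cong: measurable_cong_sets sets_pair_measure_cong)
  ultimately show ?thesis
    using nn_integral_cong[of "count_events M Y" "\<lambda>\<omega>. \<integral>\<^sup>+z. F (\<omega>, z) \<partial>(?\<nu> \<Otimes>\<^sub>M ?\<nu>)"
        "\<lambda>\<omega>. \<integral>\<^sup>+x. \<integral>\<^sup>+x'. F (\<omega>, x, x') \<partial>?\<nu> \<partial>?\<nu>"]
    by (simp add: sum2[symmetric] case_prod_beta')
qed

end

end

section \<open>Sums over points as functions of the counts\<close>

text \<open>For indicators of rectangles the sum is a count, and a monotone class argument extends this to all
measurable functions. Complements need a subtraction, so the sum is restricted to a set \<open>K\<close> and to the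
event that \<open>K\<close> contains finitely many points.\<close>

lemma measurable_sum_points_local:
  fixes Y :: "nat \<Rightarrow> 'w \<Rightarrow> 'b::euclidean_space" and Z :: "'z measure"
  assumes K [measurable]: "K \<in> sets borel"
    and v: "v \<in> borel_measurable (Z \<Otimes>\<^sub>M borel)"
  shows "(\<lambda>(z, \<omega>). (if point_count Y K \<omega> < \<infinity> then \<integral>\<^sup>+i. v (z, Y i \<omega>) * indicator K (Y i \<omega>) \<partial>count_space UNIV else 0))
    \<in> borel_measurable (Z \<Otimes>\<^sub>M count_events M Y)"
proof -
  define S where "S = (\<lambda>v (z, \<omega>). if point_count Y K \<omega> < \<infinity>
    then \<integral>\<^sup>+i. v (z :: 'z, Y i \<omega>) * indicator K (Y i \<omega>) \<partial>count_space UNIV else (0 :: ennreal))"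
  let ?N = "Z \<Otimes>\<^sub>M count_events M Y"
  have [measurable]: "(\<lambda>p. point_count Y K (snd p)) \<in> borel_measurable ?N"
    by measurable
  have "(\<lambda>p. S v p) \<in> borel_measurable ?N"
    using v
  proof (induction v rule: borel_measurable_induct)
    case (cong f g)
    have "S f p = S g p" if "p \<in> space ?N" for p
      using that cong(3) by (auto simp: S_def space_pair_measure intro!: nn_integral_cong)
    then show ?case using cong(4) by (simp cong: measurable_cong)
  next
    case (set D)
    have "D \<in> sigma_sets (space Z \<times> space (borel :: 'b measure)) {a \<times> b | a b. a \<in> sets Z \<and> b \<in> sets (borel :: 'b measure)}"
      using set by (simp add: sets_pair_measure)
    with Int_stable_pair_measure_generator pair_measure_closed show ?case
    proof (induct rule: sigma_sets_induct_disjoint)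
      case (basic D)
      then obtain A B where D: "D = A \<times> B" and [measurable]: "A \<in> sets Z" "B \<in> sets borel" by auto
      have "S (indicator D) = (\<lambda>p. if point_count Y K (snd p) < \<infinity>
          then indicator A (fst p) * point_count Y (B \<inter> K) (snd p) else 0)"
        by (auto simp: S_def D indicator_times indicator_inter_arith point_count_def nn_integral_count_space_nat
            fun_eq_iff mult.assoc)
      then show ?case by simp
    next
      case empty
      have "S (indicator {}) = (\<lambda>_. 0)" by (auto simp: S_def fun_eq_iff)
      then show ?case by (simp only:) simp
    next
      case (compl D)
      have fin: "S (indicator D) p \<noteq> \<top>" for p
      proof -
        have "S (indicator D) p \<le> (if point_count Y K (snd p) < \<infinity> then point_count Y K (snd p) else 0)"
          by (auto simp: S_def case_prod_beta' point_count_def nn_integral_count_space_nat[symmetric] intro!: nn_integral_mono split: split_indicator)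
        then show ?thesis by (auto simp: top_unique split: if_splits)
      qed
      have "S (indicator (space Z \<times> space borel - D)) p =
          (if point_count Y K (snd p) < \<infinity> then point_count Y K (snd p) else 0) - S (indicator D) p"
        if "p \<in> space ?N" for p
      proof -
        have "S (indicator (space Z \<times> space borel - D)) p + S (indicator D) p =
          (if point_count Y K (snd p) < \<infinity> then point_count Y K (snd p) else 0)"
          using that
          by (auto simp: S_def case_prod_beta' point_count_def nn_integral_count_space_nat[symmetric]
              nn_integral_add[symmetric] space_pair_measure intro!: nn_integral_cong split: split_indicator)
        note sum = this
        show ?thesis
          unfolding sum[symmetric] by (rule ennreal_add_diff_cancel_right[OF fin, symmetric])
      qed
      then show ?case using compl(2) by (simp cong: measurable_cong)
    next
      case (union D)
      have "S (indicator (\<Union>i. D i)) p = (\<Sum>i. S (indicator (D i)) p)" for p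
      proof -
        have "(\<integral>\<^sup>+i. (indicator (\<Union>i. D i) (fst p, Y i (snd p)) :: ennreal) * indicator K (Y i (snd p)) \<partial>count_space UNIV)
           = (\<integral>\<^sup>+i. (\<Sum>n. indicator (D n) (fst p, Y i (snd p)) * indicator K (Y i (snd p))) \<partial>count_space UNIV)"
          by (simp only: ennreal_suminf_multc suminf_indicator[OF union(1)])
        also have "\<dots> = (\<Sum>n. \<integral>\<^sup>+i. indicator (D n) (fst p, Y i (snd p)) * indicator K (Y i (snd p)) \<partial>count_space UNIV)"
          by (rule nn_integral_suminf) simp
        finally show ?thesis by (simp add: S_def case_prod_beta')
      qed
      then show ?case using union(3) by (simp add: fun_eq_iff[symmetric])
    qed
  next
    case (mult u c)
    have "S (\<lambda>x. c * u x) = (\<lambda>p. c * S u p)"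
      by (auto simp: S_def fun_eq_iff nn_integral_cmult mult.assoc)
    then show ?case using mult by simp
  next
    case (add u v)
    have "S (\<lambda>x. v x + u x) = (\<lambda>p. S v p + S u p)"
      by (auto simp: S_def fun_eq_iff nn_integral_add[symmetric] distrib_right)
    then show ?case using add by simp
  next
    case (seq U)
    have "S (SUP i. U i) p = (SUP i. S (U i) p)" for p
    proof -
      have inc: "incseq (\<lambda>n i. U n (fst p, Y i (snd p)) * indicator K (Y i (snd p)))"
        using \<open>incseq U\<close> by (auto simp: incseq_def le_fun_def intro!: mult_right_mono)
      have "(\<integral>\<^sup>+i. (SUP n. U n) (fst p, Y i (snd p)) * indicator K (Y i (snd p)) \<partial>count_space UNIV)
         = (\<integral>\<^sup>+i. (SUP n. U n (fst p, Y i (snd p)) * indicator K (Y i (snd p))) \<partial>count_space UNIV)"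
        by (simp add: SUP_mult_right_ennreal SUP_apply image_comp comp_def)
      also have "\<dots> = (SUP n. \<integral>\<^sup>+i. U n (fst p, Y i (snd p)) * indicator K (Y i (snd p)) \<partial>count_space UNIV)"
        by (rule nn_integral_monotone_convergence_SUP[OF inc]) simp
      finally show ?thesis by (simp add: S_def case_prod_beta')
    qed
    moreover have "(\<lambda>p. SUP i. S (U i) p) \<in> borel_measurable ?N"
      using seq.IH by (intro borel_measurable_SUP) auto
    ultimately show ?case by (simp only:)
  qed
  then show ?thesis by (simp add: S_def)
qed

text \<open>The annuli form a partition of the space into countably many bounded Borel sets.\<close>

definition annulus :: "nat \<Rightarrow> 'b::euclidean_space set" where
  "annulus n = {y. nat \<lfloor>norm y\<rfloor> = n}"

lemma annulus_borel [measurable]: "annulus n \<in> sets borel"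
  unfolding annulus_def by measurable

lemma emeasure_annulus_finite: "emeasure lborel (annulus n :: 'b::euclidean_space set) < \<infinity>"
proof -
  have "annulus n \<subseteq> cball (0 :: 'b) (real n + 1)"
    unfolding annulus_def by (auto simp: dist_norm)
  then have "emeasure lborel (annulus n :: 'b set) \<le> emeasure lborel (cball (0 :: 'b) (real n + 1))"
    by (intro emeasure_mono) auto
  then show ?thesis
    using emeasure_lborel_cball_finite le_less_trans by blast
qed

lemma suminf_indicator_annulus: "(\<Sum>n. indicator (annulus n) y :: ennreal) = 1"
  by (subst suminf_finite[of "{nat \<lfloor>norm y\<rfloor>}"]) (auto simp: annulus_def)

definition locally_finite_event :: "'w measure \<Rightarrow> (nat \<Rightarrow> 'w \<Rightarrow> 'b::euclidean_space) \<Rightarrow> 'w set" where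
  "locally_finite_event M Y = {\<omega> \<in> space M. \<forall>n. point_count Y (annulus n) \<omega> < \<infinity>}"

lemma locally_finite_event_sets [measurable]:
  "locally_finite_event M Y \<in> sets (count_events M Y)"
proof -
  have [measurable]: "\<And>n. point_count Y (annulus n) \<in> borel_measurable (count_events M Y)" by measurable
  have "{\<omega> \<in> space (count_events M Y). \<forall>n. point_count Y (annulus n) \<omega> < \<infinity>} \<in> sets (count_events M Y)"
    by measurable
  then show ?thesis by (simp add: locally_finite_event_def)
qed

lemma (in prob_space) AE_locally_finite_event:
  assumes "homogeneous_ppp M lam Y" "lam > 0"
  shows "AE \<omega> in M. \<omega> \<in> locally_finite_event M Y"
proof -
  have "AE \<omega> in M. \<forall>n. point_count Y (annulus n) \<omega> < \<infinity>"
    using point_count_finite_AE[OF assms annulus_borel emeasure_annulus_finite] by (simp add: AE_all_countable)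
  with AE_space show ?thesis by eventually_elim (simp add: locally_finite_event_def)
qed

text \<open>Summing the local statement over the annuli. Outside of the event of local finiteness, which is null for
a Poisson process, the sum is replaced by zero.\<close>

lemma measurable_sum_points:
  fixes Y :: "nat \<Rightarrow> 'w \<Rightarrow> 'b::euclidean_space" and Z :: "'z measure" and v :: "'z \<times> 'b \<Rightarrow> ennreal"
  assumes v: "v \<in> borel_measurable (Z \<Otimes>\<^sub>M borel)"
  shows "(\<lambda>(z, \<omega>). indicator (locally_finite_event M Y) \<omega> * (\<Sum>i. v (z, Y i \<omega>)))
    \<in> borel_measurable (Z \<Otimes>\<^sub>M count_events M Y)"
proof -
  define S where "S = (\<lambda>n (z, \<omega>). if point_count Y (annulus n) \<omega> < \<infinity>
     then \<integral>\<^sup>+i. v (z, Y i \<omega>) * indicator (annulus n) (Y i \<omega>) \<partial>count_space UNIV else 0)"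
  have [measurable]: "S n \<in> borel_measurable (Z \<Otimes>\<^sub>M count_events M Y)" for n
    unfolding S_def using v by (intro measurable_sum_points_local) auto
  have "indicator (locally_finite_event M Y) \<omega> * (\<Sum>i. v (z, Y i \<omega>)) =
      indicator (locally_finite_event M Y) \<omega> * (\<Sum>n. S n (z, \<omega>))" for z \<omega>
  proof (cases "\<omega> \<in> locally_finite_event M Y")
    case True
    have "(\<Sum>i. v (z, Y i \<omega>)) = (\<integral>\<^sup>+i. (\<Sum>n. v (z, Y i \<omega>) * indicator (annulus n) (Y i \<omega>)) \<partial>count_space UNIV)"
      by (simp add: suminf_indicator_annulus nn_integral_count_space_nat)
    also have "\<dots> = (\<Sum>n. S n (z, \<omega>))"
      using True by (subst nn_integral_suminf) (auto simp: locally_finite_event_def S_def)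
    finally show ?thesis by simp
  qed simp
  then have "(\<lambda>(z, \<omega>). indicator (locally_finite_event M Y) \<omega> * (\<Sum>i. v (z, Y i \<omega>))) =
     (\<lambda>p. indicator (locally_finite_event M Y) (snd p) * (\<Sum>n. S n p))"
    by auto
  then show ?thesis by (simp only:) measurable
qed


section \<open>Averaged contribution of a user, given the base stations\<close>

definition link_loss :: "('b::euclidean_space \<Rightarrow> real) \<Rightarrow> real \<Rightarrow> 'b \<Rightarrow> 'b \<Rightarrow> ennreal" where
  "link_loss L t y x = inverse (ennreal (t * L (y - x)))"

lemma link_loss_measurable [measurable]:
  assumes [measurable]: "L \<in> borel_measurable borel" "a \<in> borel_measurable N" "b \<in> borel_measurable N" "c \<in> borel_measurable N"
  shows "(\<lambda>p. link_loss L (a p) (b p) (c p)) \<in> borel_measurable N"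
  unfolding link_loss_def by measurable

text \<open>The summand of the cell capacity for a user at \<open>x\<close>, as a function of the fading \<open>t\<close> of its link to the
origin, of the fading \<open>\<eta> i\<close> of its link to the \<open>i\<close>-th base station, and of the base stations \<open>y i\<close>.\<close>

definition served_value ::
  "('b::euclidean_space \<Rightarrow> real) \<Rightarrow> (real \<Rightarrow> real) \<Rightarrow> real \<Rightarrow> (nat \<Rightarrow> real) \<Rightarrow> (nat \<Rightarrow> 'b) \<Rightarrow> 'b \<Rightarrow> ennreal" where
  "served_value L f t \<eta> y x =
     (if link_loss L t 0 x < (INF i. link_loss L (\<eta> i) (y i) x)
      then ennreal (f (enn2real (link_loss L t 0 x))) else 0)"

lemma served_value_measurable:
  assumes [measurable]: "L \<in> borel_measurable borel" "(\<lambda>s. f (enn2real s)) \<in> borel_measurable borel"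
    "t \<in> borel_measurable N" "\<And>i. (\<lambda>p. \<eta> p i) \<in> borel_measurable N" "\<And>i. (\<lambda>p. y p i) \<in> borel_measurable N"
    "x \<in> borel_measurable N"
  shows "(\<lambda>p. served_value L f (t p) (\<eta> p) (y p) (x p)) \<in> borel_measurable N"
proof -
  have [measurable]: "(\<lambda>p. f (enn2real (link_loss L (t p) 0 (x p)))) \<in> borel_measurable N"
    by (rule measurable_compose[OF _ assms(2)]) measurable
  show ?thesis unfolding served_value_def by measurable
qed

definition mean_served ::
  "real measure \<Rightarrow> ('b::euclidean_space \<Rightarrow> real) \<Rightarrow> (real \<Rightarrow> real) \<Rightarrow> (nat \<Rightarrow> 'b) \<Rightarrow> 'b \<Rightarrow> ennreal" where
  "mean_served \<mu> L f y x =
     (\<integral>\<^sup>+t. \<integral>\<^sup>+\<eta>. served_value L f t \<eta> y x \<partial>PiM UNIV (\<lambda>_. \<mu>) \<partial>\<mu>)"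

text \<open>The pair \<open>neg_ln\<close>, \<open>exp_neg\<close> is \<open>- ln\<close> and \<open>exp (- _)\<close> with the convention \<open>- ln 0 = \<infinity>\<close>. It turns an
infinite product of probabilities into a sum over points.\<close>

definition neg_ln :: "real \<Rightarrow> ennreal" where
  "neg_ln u = (if u = 0 then \<top> else ennreal (- ln u))"

definition exp_neg :: "ennreal \<Rightarrow> ennreal" where
  "exp_neg r = (if r = \<top> then 0 else ennreal (exp (- enn2real r)))"

lemma neg_ln_measurable [measurable]: "neg_ln \<in> borel_measurable borel"
  unfolding neg_ln_def[abs_def] by measurable

lemma exp_neg_measurable [measurable]: "exp_neg \<in> borel_measurable borel"
  unfolding exp_neg_def[abs_def] by measurable

text \<open>A vanishing factor makes both sides zero. Otherwise the partial products are \<open>exp\<close> of the negated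
partial sums, which may diverge to \<open>\<infinity>\<close>.\<close>

lemma limit_prod_eq_exp_neg_sum:
  fixes u :: "nat \<Rightarrow> real"
  assumes u: "\<And>i. 0 \<le> u i" "\<And>i. u i \<le> 1" and lim: "(\<lambda>n. \<Prod>i\<le>n. u i) \<longlonglongrightarrow> p"
  shows "ennreal p = exp_neg (\<Sum>i. neg_ln (u i))"
proof -
  define v where "v = (\<lambda>i. neg_ln (u i))"
  have "p = (if (\<Sum>i. v i) = \<top> then 0 else exp (- enn2real (\<Sum>i. v i)))"
  proof (cases "\<exists>i. u i = 0")
    case True
    then obtain k where k: "u k = 0" by auto
    have "v k \<le> (\<Sum>i. v i)"
      using sum_le_suminf[of v "{k}"] by auto
    then have top: "(\<Sum>i. v i) = \<top>" using k by (simp add: v_def neg_ln_def top_unique)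
    have "eventually (\<lambda>n. (\<Prod>i\<le>n. u i) = 0) sequentially"
      using k by (auto simp: eventually_sequentially intro!: exI[of _ k])
    then have "(\<lambda>n. \<Prod>i\<le>n. u i) \<longlonglongrightarrow> 0" by (rule tendsto_eventually)
    with lim have "p = 0" by (rule LIMSEQ_unique)
    then show ?thesis using top by simp
  next
    case False
    define x where "x = (\<lambda>i. - ln (u i))"
    have pos: "u i > 0" for i using False u(1)[of i] by (auto simp: less_le)
    have x: "x i \<ge> 0" for i using pos[of i] u(2)[of i] by (simp add: x_def)
    have v: "v = (\<lambda>i. ennreal (x i))" using False by (auto simp: v_def neg_ln_def x_def)
    have prod: "(\<Prod>i\<le>n. u i) = exp (- (\<Sum>i\<le>n. x i))" for n
      using pos by (simp add: x_def sum_negf exp_sum)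
    show ?thesis
    proof (cases "(\<Sum>i. v i) = \<top>")
      case True
      have "(\<lambda>n. ennreal (\<Sum>i\<le>n. x i)) \<longlonglongrightarrow> \<top>"
        using summable_LIMSEQ'[OF summableI[of v]] x True unfolding v by (simp add: sum_ennreal)
      then have "filterlim (\<lambda>n. \<Sum>i\<le>n. x i) at_top sequentially"
        by (simp add: ennreal_tendsto_top_eq_at_top)
      then have "(\<lambda>n. exp (- (\<Sum>i\<le>n. x i))) \<longlonglongrightarrow> 0"
        by (intro filterlim_compose[OF exp_at_bot] filterlim_compose[OF filterlim_uminus_at_bot_at_top])
      then show ?thesis using LIMSEQ_unique[OF lim] True by (simp add: prod)
    next
      case False
      then have "summable x" using x by (intro summable_suminf_not_top) (auto simp: v)
      then have "(\<lambda>n. exp (- (\<Sum>i\<le>n. x i))) \<longlonglongrightarrow> exp (- suminf x)"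
        by (intro tendsto_intros summable_LIMSEQ')
      moreover have "enn2real (\<Sum>i. v i) = suminf x"
        using \<open>summable x\<close> x by (simp add: v suminf_ennreal2 suminf_nonneg)
      ultimately show ?thesis using LIMSEQ_unique[OF lim] False by (simp add: prod)
    qed
  qed
  then show ?thesis by (simp add: v_def exp_neg_def)
qed

definition far_prob :: "real measure \<Rightarrow> ('b::euclidean_space \<Rightarrow> real) \<Rightarrow> ennreal \<Rightarrow> 'b \<Rightarrow> 'b \<Rightarrow> real" where
  "far_prob \<mu> L c x y = measure \<mu> {t. c \<le> link_loss L t y x}"

context
  fixes \<mu> :: "real measure" and L :: "'b::euclidean_space \<Rightarrow> real"
  assumes \<mu>: "prob_space \<mu>" and sets_\<mu> [measurable_cong, simp]: "sets \<mu> = sets borel"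
    and L [measurable]: "L \<in> borel_measurable borel"
begin

interpretation \<mu>: prob_space \<mu> by (rule \<mu>)

interpretation sequence_space \<mu> by unfold_locales

lemma space_\<mu> [simp]: "space \<mu> = UNIV"
  using sets_eq_imp_space_eq[OF sets_\<mu>] by simp

lemma far_prob_measurable [measurable]:
  "(\<lambda>(z, y). far_prob \<mu> L (fst z) (snd z) y) \<in> borel_measurable ((borel \<Otimes>\<^sub>M borel) \<Otimes>\<^sub>M borel)"
proof -
  let ?N = "((borel \<Otimes>\<^sub>M borel) \<Otimes>\<^sub>M borel) :: ((ennreal \<times> 'b) \<times> 'b) measure"
  let ?Q = "{q \<in> space (?N \<Otimes>\<^sub>M \<mu>). fst (fst (fst q)) \<le> link_loss L (snd q) (snd (fst q)) (snd (fst (fst q)))}"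
  have "?Q \<in> sets (?N \<Otimes>\<^sub>M \<mu>)" by measurable
  from \<mu>.measurable_emeasure_Pair[OF this]
  have "(\<lambda>p. enn2real (emeasure \<mu> (Pair p -` ?Q))) \<in> borel_measurable ?N" by measurable
  moreover have "Pair p -` ?Q = {t. fst (fst p) \<le> link_loss L t (snd p) (snd (fst p))}" for p
    by (auto simp: space_pair_measure)
  ultimately show ?thesis by (simp add: far_prob_def measure_def case_prod_beta')
qed

lemma emeasure_all_far:
  "emeasure S {\<eta>. \<forall>i. c \<le> link_loss L (\<eta> i) (y i) x} = exp_neg (\<Sum>i. neg_ln (far_prob \<mu> L c x (y i)))"
proof -
  define E where "E = (\<lambda>i. {t. c \<le> link_loss L t (y i) x})"
  have [measurable]: "E i \<in> sets \<mu>" for i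
    unfolding E_def by measurable
  have "(\<lambda>n. \<Prod>i\<le>n. far_prob \<mu> L c x (y i)) \<longlonglongrightarrow> measure S (Pi UNIV E)"
    using measure_PiM_countable[of E] by (simp add: far_prob_def E_def)
  have "0 \<le> far_prob \<mu> L c x z" "far_prob \<mu> L c x z \<le> 1" for z
    by (auto simp: far_prob_def)
  from limit_prod_eq_exp_neg_sum[OF this \<open>(\<lambda>n. \<Prod>i\<le>n. far_prob \<mu> L c x (y i)) \<longlonglongrightarrow> _\<close>]
  have "emeasure S (Pi UNIV E) = exp_neg (\<Sum>i. neg_ln (far_prob \<mu> L c x (y i)))"
    by (simp add: emeasure_eq_measure)
  also have "Pi UNIV E = {\<eta>. \<forall>i. c \<le> link_loss L (\<eta> i) (y i) x}"
    by (auto simp: E_def)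
  finally show ?thesis .
qed

text \<open>The strict inequality for the infimum is not a statement about each base station separately. For
finite \<open>s\<close> it is the increasing union over \<open>m\<close> of the events that all path loss fadings are at least \<open>s + 1 / (m + 1)\<close>,
which are.\<close>

lemma emeasure_all_strictly_far:
  "emeasure S {\<eta>. s < (INF i. link_loss L (\<eta> i) (y i) x)} =
    of_bool (s < \<top>) * (SUP m. exp_neg (\<Sum>i. neg_ln (far_prob \<mu> L (s + ennreal (1 / real (Suc m))) x (y i))))"
proof (cases "s < \<top>")
  case False
  then have "s = \<top>" by (simp add: less_top[symmetric])
  then have "{\<eta>. s < (INF i. link_loss L (\<eta> i) (y i) x)} = {}" by simp
  then show ?thesis using False by simp
next
  case True
  define c where "c = (\<lambda>m. s + ennreal (1 / real (Suc m)))"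
  let ?F = "\<lambda>m. {\<eta>. \<forall>i. c m \<le> link_loss L (\<eta> i) (y i) x}"
  have "s < I \<longleftrightarrow> (\<exists>m. c m \<le> I)" for I
  proof
    assume "\<exists>m. c m \<le> I"
    then obtain m where "c m \<le> I" ..
    moreover have "s < c m" using True by (auto simp: c_def ennreal_add_left_cancel_less less_top[symmetric])
    ultimately show "s < I" by simp
  next
    assume "s < I"
    show "\<exists>m. c m \<le> I"
    proof (cases "I = \<top>")
      case False
      then obtain a b where ab: "s = ennreal a" "I = ennreal b" "0 \<le> a" "0 \<le> b"
        using True by (cases s; cases I) auto
      then have "a < b" using \<open>s < I\<close> by (simp add: ennreal_less_iff)
      then obtain m where "inverse (real (Suc m)) < b - a"
        using reals_Archimedean[of "b - a"] by auto
      then have "c m \<le> I" using ab by (simp add: c_def ennreal_plus[symmetric] inverse_eq_divide del: ennreal_plus of_nat_Suc)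
      then show ?thesis ..
    qed auto
  qed
  then have "{\<eta>. s < (INF i. link_loss L (\<eta> i) (y i) x)} = (\<Union>m. ?F m)"
    by (auto simp: le_INF_iff)
  moreover have "incseq ?F"
  proof (rule incseq_SucI)
    fix m
    have "c (Suc m) \<le> c m" unfolding c_def by (intro add_left_mono ennreal_leI) (simp add: field_simps)
    then show "?F m \<le> ?F (Suc m)" by (auto intro: order_trans)
  qed
  moreover have "?F m \<in> sets S" for m
  proof -
    have "{\<eta> \<in> space S. \<forall>i. c m \<le> link_loss L (\<eta> i) (y i) x} \<in> sets S" by measurable
    then show ?thesis by (simp add: space_PiM)
  qed
  ultimately have "emeasure S {\<eta>. s < (INF i. link_loss L (\<eta> i) (y i) x)} = (SUP m. emeasure S (?F m))"
    by (simp add: SUP_emeasure_incseq image_subset_iff)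
  then show ?thesis using True by (simp add: emeasure_all_far c_def)
qed

lemma mean_served_eq:
  assumes f: "(\<lambda>s. f (enn2real s)) \<in> borel_measurable borel"
  shows "mean_served \<mu> L f y x = (\<integral>\<^sup>+t. ennreal (f (enn2real (link_loss L t 0 x))) *
    (of_bool (link_loss L t 0 x < \<top>) *
     (SUP m. exp_neg (\<Sum>i. neg_ln (far_prob \<mu> L (link_loss L t 0 x + ennreal (1 / real (Suc m))) x (y i))))) \<partial>\<mu>)"
  unfolding mean_served_def
proof (intro nn_integral_cong)
  fix t
  let ?s = "link_loss L t 0 x" and ?A = "{\<eta>. link_loss L t 0 x < (INF i. link_loss L (\<eta> i) (y i) x)}"
  have "(\<lambda>\<eta>. \<eta> i) \<in> borel_measurable S" for i
    using measurable_component_singleton[of i UNIV "\<lambda>_. \<mu>"] by (simp cong: measurable_cong_sets)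
  then have [measurable]: "(\<lambda>\<eta>. link_loss L (\<eta> i) (y i) x) \<in> borel_measurable S" for i
    by (intro link_loss_measurable[OF L]) auto
  have [measurable]: "(\<lambda>\<eta>. INF i. link_loss L (\<eta> i) (y i) x) \<in> borel_measurable S"
    by (intro borel_measurable_INF) auto
  have "{\<eta> \<in> space S. ?s < (INF i. link_loss L (\<eta> i) (y i) x)} \<in> sets S"
    by (rule borel_measurable_less) auto
  then have A: "?A \<in> sets S" by (simp add: space_PiM)
  have "(\<integral>\<^sup>+\<eta>. served_value L f t \<eta> y x \<partial>S) = (\<integral>\<^sup>+\<eta>. ennreal (f (enn2real ?s)) * indicator ?A \<eta> \<partial>S)"
    by (intro nn_integral_cong) (simp add: served_value_def)
  also have "\<dots> = ennreal (f (enn2real ?s)) * emeasure S ?A"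
    by (rule nn_integral_cmult_indicator[OF A])
  finally show "(\<integral>\<^sup>+\<eta>. served_value L f t \<eta> y x \<partial>S) = ennreal (f (enn2real ?s)) * (of_bool (?s < \<top>) *
     (SUP m. exp_neg (\<Sum>i. neg_ln (far_prob \<mu> L (?s + ennreal (1 / real (Suc m))) x (y i)))))"
    by (simp only: emeasure_all_strictly_far)
qed

text \<open>Although \<open>mean_served\<close> refers to the enumeration of the base stations, it is a functional of their
counts: by the previous identity it is built from sums over the points of \<open>Y\<close>.\<close>

lemma mean_served_measurable:
  fixes Y :: "nat \<Rightarrow> 'w \<Rightarrow> 'b"
  assumes f: "(\<lambda>s. f (enn2real s)) \<in> borel_measurable borel"
  shows "(\<lambda>(\<omega>, x). indicator (locally_finite_event M Y) \<omega> * mean_served \<mu> L f (\<lambda>i. Y i \<omega>) x)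
    \<in> borel_measurable (count_events M Y \<Otimes>\<^sub>M borel)"
proof -
  let ?G = "locally_finite_event M Y"
  let ?N = "count_events M Y \<Otimes>\<^sub>M (borel :: 'b measure)"
  define W where "W = (\<lambda>(z, \<omega>). indicator ?G \<omega> * (\<Sum>i. neg_ln (far_prob \<mu> L (fst z) (snd z) (Y i \<omega>))))"
  have W: "W \<in> borel_measurable ((borel \<Otimes>\<^sub>M borel) \<Otimes>\<^sub>M count_events M Y)"
    unfolding W_def
    using measurable_sum_points[of "\<lambda>(z, y). neg_ln (far_prob \<mu> L (fst z) (snd z) y)" "borel \<Otimes>\<^sub>M borel" M Y]
      measurable_compose[OF far_prob_measurable neg_ln_measurable] by (simp add: case_prod_beta')
  have [measurable]: "(\<lambda>q. ennreal (f (enn2real (link_loss L (snd q) 0 (snd (fst q)))))) \<in> borel_measurable (?N \<Otimes>\<^sub>M \<mu>)"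
    by (intro measurable_compose[OF _ measurable_ennreal] measurable_compose[OF _ f]) measurable
  have [measurable]: "(\<lambda>q. W ((link_loss L (snd q) 0 (snd (fst q)) + ennreal (1 / real (Suc m)), snd (fst q)), fst (fst q)))
      \<in> borel_measurable (?N \<Otimes>\<^sub>M \<mu>)" for m
    by (rule measurable_compose[OF _ W]) measurable
  define V where "V = (\<lambda>p t. indicator ?G (fst p) * (ennreal (f (enn2real (link_loss L t 0 (snd p)))) *
      (of_bool (link_loss L t 0 (snd p) < \<top>) *
       (SUP m. exp_neg (W ((link_loss L t 0 (snd p) + ennreal (1 / real (Suc m)), snd p), fst p))))))"
  have "(\<lambda>p. \<integral>\<^sup>+t. V p t \<partial>\<mu>) \<in> borel_measurable ?N"
    unfolding V_def by (intro \<mu>.borel_measurable_nn_integral) (unfold case_prod_beta', measurable)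
  moreover have "indicator ?G \<omega> * mean_served \<mu> L f (\<lambda>i. Y i \<omega>) x = (\<integral>\<^sup>+t. V (\<omega>, x) t \<partial>\<mu>)" for \<omega> x
    by (cases "\<omega> \<in> ?G") (simp_all add: mean_served_eq[OF f] W_def V_def)
  ultimately show ?thesis by (simp only: case_prod_beta' prod.collapse)
qed

end

section \<open>Averaging over the fading\<close>

text \<open>The value that a user contributes if it is served.\<close>

definition demand :: "('b::euclidean_space \<Rightarrow> real) \<Rightarrow> (real \<Rightarrow> real) \<Rightarrow> real \<Rightarrow> 'b \<Rightarrow> ennreal" where
  "demand L g t x = ennreal (g (enn2real (link_loss L t 0 x)))"

lemma demand_measurable:
  assumes [measurable]: "L \<in> borel_measurable borel" "(\<lambda>s. g (enn2real s)) \<in> borel_measurable borel"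
    "t \<in> borel_measurable N" "x \<in> borel_measurable N"
  shows "(\<lambda>p. demand L g (t p) (x p)) \<in> borel_measurable N"
proof -
  have [measurable]: "(\<lambda>p. g (enn2real (link_loss L (t p) 0 (x p)))) \<in> borel_measurable N"
    by (rule measurable_compose[OF _ assms(2)]) measurable
  show ?thesis unfolding demand_def by measurable
qed

lemma served_value_le_demand: "served_value L f t \<eta> y x \<le> demand L f t x"
  by (simp add: served_value_def demand_def)

lemma served_value_mult:
  assumes "\<And>t. t \<ge> 0 \<Longrightarrow> f t \<ge> 0" "\<And>t. t \<ge> 0 \<Longrightarrow> g t \<ge> 0"
  shows "served_value L f t \<eta> y x * served_value L g t \<eta> y x = served_value L (\<lambda>s. f s * g s) t \<eta> y x"
  using assms by (simp add: served_value_def ennreal_mult)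

lemma cell_capacity_eq:
  "cell_capacity L Y X h f \<omega> =
    (\<Sum>j. served_value L f (h (None, j) \<omega>) (\<lambda>i. h (Some i, j) \<omega>) (\<lambda>i. Y i \<omega>) (X j \<omega>))"
  unfolding cell_capacity_def served_value_def link_loss_def path_loss_fading_def
    min_path_loss_fading_def station_loc_def by (simp cong: if_cong)

context prob_space
begin

context
  fixes H :: "'a \<Rightarrow> real" and Y X :: "nat \<Rightarrow> 'a \<Rightarrow> real^2" and h :: "nat option \<times> nat \<Rightarrow> 'a \<Rightarrow> real"
    and L :: "real^2 \<Rightarrow> real"
  assumes iid: "iid_fading M H Y X h" and L [measurable]: "L \<in> borel_measurable borel"
    and Y [measurable]: "\<And>i. Y i \<in> borel_measurable M" and X [measurable]: "\<And>j. X j \<in> borel_measurable M"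
begin

lemma h_measurable [measurable]: "h p \<in> borel_measurable M"
  and h_law: "distr M borel (h p) = distr M borel H"
  and h_indep: "indep_vars (\<lambda>_. borel) h UNIV"
  using iid unfolding iid_fading_def by blast+

text \<open>Given the locations, the fading variables keep their joint law.\<close>

lemma integral_out_fading:
  assumes "\<Psi> \<in> borel_measurable (PiM UNIV (\<lambda>_. borel) \<Otimes>\<^sub>M (PiM UNIV (\<lambda>_. borel) \<Otimes>\<^sub>M PiM UNIV (\<lambda>_. borel)))"
  shows "(\<integral>\<^sup>+\<omega>. \<Psi> (\<lambda>p. h p \<omega>, \<lambda>i. Y i \<omega>, \<lambda>j. X j \<omega>) \<partial>M) =
    (\<integral>\<^sup>+\<omega>. \<integral>\<^sup>+\<omega>'. \<Psi> (\<lambda>p. h p \<omega>', \<lambda>i. Y i \<omega>, \<lambda>j. X j \<omega>) \<partial>M \<partial>M)"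
proof -
  let ?P = "PiM UNIV (\<lambda>_. borel)"
  have "(\<lambda>\<omega> p. h p \<omega>) \<in> measurable M (PiM UNIV (\<lambda>_. borel))"
    by (rule measurable_PiM_single') (auto simp: space_PiM)
  moreover have "(\<lambda>\<omega> i. Y i \<omega>) \<in> measurable M (PiM UNIV (\<lambda>_. borel))"
    by (rule measurable_PiM_single') (auto simp: space_PiM)
  moreover have "(\<lambda>\<omega> i. X i \<omega>) \<in> measurable M (PiM UNIV (\<lambda>_. borel))"
    by (rule measurable_PiM_single') (auto simp: space_PiM)
  ultimately have m: "(\<lambda>\<omega> p. h p \<omega>) \<in> measurable M (PiM UNIV (\<lambda>_. borel))"
      "(\<lambda>\<omega>. (\<lambda>i. Y i \<omega>, \<lambda>j. X j \<omega>)) \<in> measurable M (PiM UNIV (\<lambda>_. borel) \<Otimes>\<^sub>M PiM UNIV (\<lambda>_. borel))"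
    by (auto intro: measurable_Pair)
  show ?thesis
  proof (rule nn_integral_product_law[OF m _ assms])
    fix A :: "(nat option \<times> nat \<Rightarrow> real) set" and B :: "((nat \<Rightarrow> real^2) \<times> (nat \<Rightarrow> real^2)) set"
    assume "A \<in> sets (PiM UNIV (\<lambda>_. borel))" "B \<in> sets (PiM UNIV (\<lambda>_. borel) \<Otimes>\<^sub>M PiM UNIV (\<lambda>_. borel))"
    then show "prob ((\<lambda>\<omega> p. h p \<omega>) -` A \<inter> space M \<inter> ((\<lambda>\<omega>. (\<lambda>i. Y i \<omega>, \<lambda>j. X j \<omega>)) -` B \<inter> space M)) =
        prob ((\<lambda>\<omega> p. h p \<omega>) -` A \<inter> space M) * prob ((\<lambda>\<omega>. (\<lambda>i. Y i \<omega>, \<lambda>j. X j \<omega>)) -` B \<inter> space M)"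
      using iid unfolding iid_fading_def indep_sets2_eq by (auto simp: in_vimage_algebra)
  qed
qed

lemma neighbour_fading_law:
  "distr M (PiM UNIV (\<lambda>_. borel)) (\<lambda>\<omega> i. h (Some i, j) \<omega>) = PiM UNIV (\<lambda>_. (distr M borel H))"
proof -
  have "indep_vars (\<lambda>i. PiM {(Some i, j)} (\<lambda>_. borel)) (\<lambda>i \<omega>. restrict (\<lambda>p. h p \<omega>) {(Some i, j)}) UNIV"
    by (rule indep_vars_restrict[OF h_indep]) (auto simp: disjoint_family_on_def)
  then have "indep_vars (\<lambda>_. borel) (\<lambda>i \<omega>. (restrict (\<lambda>p. h p \<omega>) {(Some i, j)}) (Some i, j)) UNIV"
    by (rule indep_vars_compose2) (rule measurable_component_singleton, simp)
  then have "indep_vars (\<lambda>_. borel) (\<lambda>i. h (Some i, j)) UNIV" by simp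
  then show ?thesis
    by (subst (asm) indep_vars_iff_distr_eq_PiM') (auto simp: h_law restrict_UNIV)
qed

lemma fading_groups_indep:
  "A \<inter> B = {} \<Longrightarrow> indep_var (PiM A (\<lambda>_. borel)) (\<lambda>\<omega>. restrict (\<lambda>p. h p \<omega>) A)
      (PiM B (\<lambda>_. borel)) (\<lambda>\<omega>. restrict (\<lambda>p. h p \<omega>) B)"
  by (rule indep_var_restrict[OF h_indep]) auto

lemma mean_served_fading:
  assumes f: "(\<lambda>s. f (enn2real s)) \<in> borel_measurable borel"
  shows "(\<integral>\<^sup>+\<omega>. served_value L f (h (None, j) \<omega>) (\<lambda>i. h (Some i, j) \<omega>) y x \<partial>M) = mean_served (distr M borel H) L f y x"
proof -
  let ?A = "range (\<lambda>i. (Some i, j))" and ?B = "{(None, j)}"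
  have "(\<integral>\<^sup>+\<omega>. served_value L f (h (None, j) \<omega>) (\<lambda>i. h (Some i, j) \<omega>) y x \<partial>M) =
     (\<integral>\<^sup>+\<omega>. \<integral>\<^sup>+\<omega>'. served_value L f (h (None, j) \<omega>) (\<lambda>i. h (Some i, j) \<omega>') y x \<partial>M \<partial>M)"
  proof -
    have "(\<lambda>z. served_value L f (snd z (None, j)) (\<lambda>i. fst z (Some i, j)) y x)
        \<in> borel_measurable (PiM ?A (\<lambda>_. borel) \<Otimes>\<^sub>M PiM ?B (\<lambda>_. borel))"
      by (intro served_value_measurable L f fst_component snd_component) auto
    from indep_var_nn_integral[OF fading_groups_indep this] show ?thesis by auto
  qed
  also have "\<dots> = (\<integral>\<^sup>+\<omega>. \<integral>\<^sup>+\<eta>. served_value L f (h (None, j) \<omega>) \<eta> y x \<partial>PiM UNIV (\<lambda>_. (distr M borel H)) \<partial>M)"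
    unfolding neighbour_fading_law[of j, symmetric]
    by (intro nn_integral_cong, subst nn_integral_distr)
      (auto intro!: served_value_measurable L f measurable_PiM_single' measurable_component_singleton simp: space_PiM)
  also have "\<dots> = (\<integral>\<^sup>+t. \<integral>\<^sup>+\<eta>. served_value L f t \<eta> y x \<partial>PiM UNIV (\<lambda>_. (distr M borel H)) \<partial>distr M borel (h (None, j)))"
  proof -
    interpret \<mu>: prob_space "distr M borel H"
      using prob_space_distr[OF h_measurable[of "(None, j)"]] by (simp add: h_law)
    interpret D: prob_space "PiM (UNIV :: nat set) (\<lambda>_. (distr M borel H))"
      by (rule prob_space_PiM) unfold_locales
    have "(\<lambda>z. snd z i) \<in> borel_measurable (borel \<Otimes>\<^sub>M PiM (UNIV :: nat set) (\<lambda>_. (distr M borel H)))" for i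
      using snd_component[of i UNIV borel "distr M borel H"] by simp
    then have "(\<lambda>t. \<integral>\<^sup>+\<eta>. served_value L f t \<eta> y x \<partial>PiM UNIV (\<lambda>_. (distr M borel H))) \<in> borel_measurable borel"
      by (intro D.borel_measurable_nn_integral, unfold case_prod_beta')
        (intro served_value_measurable L f; simp)
    then have "(\<lambda>t. \<integral>\<^sup>+\<eta>. served_value L f t \<eta> y x \<partial>PiM UNIV (\<lambda>_. (distr M borel H)))
        \<in> borel_measurable (distr M borel (h (None, j)))" by simp
    from nn_integral_distr[OF h_measurable this] show ?thesis by simp
  qed
  also have "\<dots> = mean_served (distr M borel H) L f y x" by (simp add: mean_served_def h_law)
  finally show ?thesis .
qed

text \<open>The fading variables at user \<open>j\<close> and the fading of the link from the origin to user \<open>k\<close> form disjoint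
groups.\<close>

lemma mean_served_demand_fading:
  assumes f: "(\<lambda>s. f (enn2real s)) \<in> borel_measurable borel" and g: "(\<lambda>s. g (enn2real s)) \<in> borel_measurable borel"
    and "j \<noteq> k"
  shows "(\<integral>\<^sup>+\<omega>. served_value L f (h (None, j) \<omega>) (\<lambda>i. h (Some i, j) \<omega>) y x * demand L g (h (None, k) \<omega>) x' \<partial>M) =
    mean_served (distr M borel H) L f y x * (\<integral>\<^sup>+t. demand L g t x' \<partial>distr M borel H)"
proof -
  let ?A = "range (\<lambda>a. (a, j))" and ?B = "{(None :: nat option, k)}"
  have "(\<integral>\<^sup>+\<omega>. served_value L f (h (None, j) \<omega>) (\<lambda>i. h (Some i, j) \<omega>) y x * demand L g (h (None, k) \<omega>) x' \<partial>M) =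
    (\<integral>\<^sup>+\<omega>. \<integral>\<^sup>+\<omega>'. served_value L f (h (None, j) \<omega>') (\<lambda>i. h (Some i, j) \<omega>') y x * demand L g (h (None, k) \<omega>) x' \<partial>M \<partial>M)"
  proof -
    have "(\<lambda>z. served_value L f (fst z (None, j)) (\<lambda>i. fst z (Some i, j)) y x * demand L g (snd z (None, k)) x')
        \<in> borel_measurable (PiM ?A (\<lambda>_. borel) \<Otimes>\<^sub>M PiM ?B (\<lambda>_. borel))"
      by (intro borel_measurable_times_ennreal served_value_measurable demand_measurable L f g
          fst_component snd_component) auto
    from indep_var_nn_integral[OF fading_groups_indep this] \<open>j \<noteq> k\<close> show ?thesis by auto
  qed
  also have "\<dots> = (\<integral>\<^sup>+\<omega>. mean_served (distr M borel H) L f y x * demand L g (h (None, k) \<omega>) x' \<partial>M)"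
    by (intro nn_integral_cong, subst nn_integral_multc)
      (auto simp: mean_served_fading[OF f] intro!: served_value_measurable L f)
  also have "\<dots> = mean_served (distr M borel H) L f y x * (\<integral>\<^sup>+\<omega>. demand L g (h (None, k) \<omega>) x' \<partial>M)"
    by (rule nn_integral_cmult) (auto intro!: demand_measurable L g)
  also have "(\<integral>\<^sup>+\<omega>. demand L g (h (None, k) \<omega>) x' \<partial>M) = (\<integral>\<^sup>+t. demand L g t x' \<partial>distr M borel H)"
    unfolding h_law[of "(None, k)", symmetric]
    by (subst nn_integral_distr) (auto intro!: demand_measurable L g)
  finally show ?thesis .
qed

lemma mean_capacity_eq:
  assumes f: "(\<lambda>s. f (enn2real s)) \<in> borel_measurable borel"
  shows "mean_capacity M L Y X h f = (\<integral>\<^sup>+\<omega>. (\<Sum>j. mean_served (distr M borel H) L f (\<lambda>i. Y i \<omega>) (X j \<omega>)) \<partial>M)"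
proof -
  have "mean_capacity M L Y X h f = (\<integral>\<^sup>+\<omega>. \<integral>\<^sup>+\<omega>'.
      (\<Sum>j. served_value L f (h (None, j) \<omega>') (\<lambda>i. h (Some i, j) \<omega>') (\<lambda>i. Y i \<omega>) (X j \<omega>)) \<partial>M \<partial>M)"
    unfolding mean_capacity_def cell_capacity_eq
    by (rule integral_out_fading[of "\<lambda>z. \<Sum>j. served_value L f (fst z (None, j)) (\<lambda>i. fst z (Some i, j))
          (fst (snd z)) (snd (snd z) j)", simplified])
      (intro borel_measurable_suminf_order served_value_measurable L f fst_component fst_snd_component
        snd_snd_component UNIV_I)
  also have "\<dots> = (\<integral>\<^sup>+\<omega>. (\<Sum>j. mean_served (distr M borel H) L f (\<lambda>i. Y i \<omega>) (X j \<omega>)) \<partial>M)"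
    by (intro nn_integral_cong, subst nn_integral_suminf)
      (auto simp: mean_served_fading[OF f] intro!: served_value_measurable L f)
  finally show ?thesis .
qed

text \<open>The term of the capacity of \<open>g\<close> for user \<open>k\<close> is bounded by its demand, for \<open>k \<noteq> j\<close> only; the diagonal
terms are kept exactly. Only then is the fading averaged out.\<close>

lemma product_capacity_le:
  assumes f: "(\<lambda>s. f (enn2real s)) \<in> borel_measurable borel" and g: "(\<lambda>s. g (enn2real s)) \<in> borel_measurable borel"
    and pos: "\<And>t. t \<ge> 0 \<Longrightarrow> f t \<ge> 0" "\<And>t. t \<ge> 0 \<Longrightarrow> g t \<ge> 0"
  shows "(\<integral>\<^sup>+\<omega>. cell_capacity L Y X h f \<omega> * cell_capacity L Y X h g \<omega> \<partial>M) \<le>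
    mean_capacity M L Y X h (\<lambda>t. f t * g t) +
    (\<integral>\<^sup>+\<omega>. (\<Sum>j k. of_bool (j \<noteq> k) * (mean_served (distr M borel H) L f (\<lambda>i. Y i \<omega>) (X j \<omega>) * (\<integral>\<^sup>+t. demand L g t (X k \<omega>) \<partial>distr M borel H))) \<partial>M)"
proof -
  let ?a = "\<lambda>f j \<omega>. served_value L f (h (None, j) \<omega>) (\<lambda>i. h (Some i, j) \<omega>) (\<lambda>i. Y i \<omega>) (X j \<omega>)"
  let ?d = "\<lambda>k \<omega>. demand L g (h (None, k) \<omega>) (X k \<omega>)"
  have [measurable]: "?a f j \<in> borel_measurable M" "?a g j \<in> borel_measurable M" "?d j \<in> borel_measurable M" for j
    by (auto intro!: served_value_measurable demand_measurable L f g)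
  have "cell_capacity L Y X h f \<omega> * cell_capacity L Y X h g \<omega> \<le>
      cell_capacity L Y X h (\<lambda>t. f t * g t) \<omega> + (\<Sum>j k. of_bool (j \<noteq> k) * (?a f j \<omega> * ?d k \<omega>))" for \<omega>
  proof -
    have diag: "?a (\<lambda>t. f t * g t) j \<omega> = (\<Sum>k. of_bool (j = k) * (?a f j \<omega> * ?a g k \<omega>))" for j
      by (subst suminf_finite[of "{j}"]) (auto simp: served_value_mult[OF pos])
    have "cell_capacity L Y X h f \<omega> * cell_capacity L Y X h g \<omega> = (\<Sum>j k. ?a f j \<omega> * ?a g k \<omega>)"
      by (simp add: cell_capacity_eq)
    also have "\<dots> = (\<Sum>j k. of_bool (j = k) * (?a f j \<omega> * ?a g k \<omega>) + of_bool (j \<noteq> k) * (?a f j \<omega> * ?a g k \<omega>))"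
      by (intro suminf_cong) auto
    also have "\<dots> = (\<Sum>j. ?a (\<lambda>t. f t * g t) j \<omega>) + (\<Sum>j k. of_bool (j \<noteq> k) * (?a f j \<omega> * ?a g k \<omega>))"
      unfolding diag by (simp add: suminf_add)
    also have "\<dots> \<le> cell_capacity L Y X h (\<lambda>t. f t * g t) \<omega> + (\<Sum>j k. of_bool (j \<noteq> k) * (?a f j \<omega> * ?d k \<omega>))"
      unfolding cell_capacity_eq
      by (intro add_left_mono suminf_le mult_left_mono served_value_le_demand) auto
    finally show ?thesis .
  qed
  then have "(\<integral>\<^sup>+\<omega>. cell_capacity L Y X h f \<omega> * cell_capacity L Y X h g \<omega> \<partial>M) \<le>
     (\<integral>\<^sup>+\<omega>. cell_capacity L Y X h (\<lambda>t. f t * g t) \<omega> + (\<Sum>j k. of_bool (j \<noteq> k) * (?a f j \<omega> * ?d k \<omega>)) \<partial>M)"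
    by (intro nn_integral_mono)
  also have "\<dots> = mean_capacity M L Y X h (\<lambda>t. f t * g t) + (\<integral>\<^sup>+\<omega>. (\<Sum>j k. of_bool (j \<noteq> k) * (?a f j \<omega> * ?d k \<omega>)) \<partial>M)"
    unfolding mean_capacity_def
  proof (rule nn_integral_add)
    show "cell_capacity L Y X h (\<lambda>t. f t * g t) \<in> borel_measurable M"
      unfolding cell_capacity_eq[abs_def]
    proof (intro borel_measurable_suminf_order served_value_measurable L)
      show "(\<lambda>s. f (enn2real s) * g (enn2real s)) \<in> borel_measurable borel"
        using f g by (rule borel_measurable_times)
    qed auto
  qed measurable
  also have "(\<integral>\<^sup>+\<omega>. (\<Sum>j k. of_bool (j \<noteq> k) * (?a f j \<omega> * ?d k \<omega>)) \<partial>M) =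
    (\<integral>\<^sup>+\<omega>. \<integral>\<^sup>+\<omega>'. (\<Sum>j k. of_bool (j \<noteq> k) *
       (served_value L f (h (None, j) \<omega>') (\<lambda>i. h (Some i, j) \<omega>') (\<lambda>i. Y i \<omega>) (X j \<omega>) * demand L g (h (None, k) \<omega>') (X k \<omega>))) \<partial>M \<partial>M)"
  proof -
    have "(\<lambda>z. \<Sum>j k. of_bool (j \<noteq> k) *
       (served_value L f (fst z (None, j)) (\<lambda>i. fst z (Some i, j)) (fst (snd z)) (snd (snd z) j) *
        demand L g (fst z (None, k)) (snd (snd z) k))) \<in> borel_measurable
          (PiM UNIV (\<lambda>_. borel) \<Otimes>\<^sub>M (PiM UNIV (\<lambda>_. borel) \<Otimes>\<^sub>M PiM UNIV (\<lambda>_. borel)))"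
      by (intro borel_measurable_suminf_order borel_measurable_times_ennreal borel_measurable_const
          served_value_measurable demand_measurable L f g fst_component fst_snd_component
          snd_snd_component UNIV_I)
    from integral_out_fading[OF this] show ?thesis by (simp only: fst_conv snd_conv)
  qed
  also have "\<dots> = (\<integral>\<^sup>+\<omega>. (\<Sum>j k. of_bool (j \<noteq> k) *
     (mean_served (distr M borel H) L f (\<lambda>i. Y i \<omega>) (X j \<omega>) * (\<integral>\<^sup>+t. demand L g t (X k \<omega>) \<partial>distr M borel H))) \<partial>M)"
  proof (rule nn_integral_cong)
    fix \<omega>
    let ?s = "\<lambda>j \<omega>'. served_value L f (h (None, j) \<omega>') (\<lambda>i. h (Some i, j) \<omega>') (\<lambda>i. Y i \<omega>) (X j \<omega>)"
    let ?e = "\<lambda>k \<omega>'. demand L g (h (None, k) \<omega>') (X k \<omega>)"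
    have [measurable]: "?s j \<in> borel_measurable M" "?e j \<in> borel_measurable M" for j
      by (auto intro!: served_value_measurable demand_measurable L f g)
    have "(\<integral>\<^sup>+\<omega>'. (\<Sum>j k. of_bool (j \<noteq> k) * (?s j \<omega>' * ?e k \<omega>')) \<partial>M) =
      (\<Sum>j k. \<integral>\<^sup>+\<omega>'. of_bool (j \<noteq> k) * (?s j \<omega>' * ?e k \<omega>') \<partial>M)"
      by (simp add: nn_integral_suminf)
    also have "\<dots> = (\<Sum>j k. of_bool (j \<noteq> k) *
       (mean_served (distr M borel H) L f (\<lambda>i. Y i \<omega>) (X j \<omega>) * (\<integral>\<^sup>+t. demand L g t (X k \<omega>) \<partial>distr M borel H)))"
      using mean_served_demand_fading[OF f g] by (intro suminf_cong) auto
    finally show "(\<integral>\<^sup>+\<omega>'. (\<Sum>j k. of_bool (j \<noteq> k) * (?s j \<omega>' * ?e k \<omega>')) \<partial>M) = \<dots>" .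
  qed
  finally show ?thesis .
qed

end

end

section \<open>The intensity of the path loss fading values\<close>

lemma AE_lborel_if_negligible:
  fixes N :: "'a::euclidean_space set"
  assumes "negligible N"
  shows "AE x in lborel. x \<notin> N"
proof -
  have "AE x in lebesgue. x \<notin> N"
    using assms by (intro AE_not_in) (simp add: negligible_iff_null_sets)
  then show ?thesis by (simp add: AE_completion_iff)
qed

text \<open>Lebesgue's differentiation theorem in the form \<open>integrable_ccontinuous_explicit\<close> concerns averages over
boxes with lower corner \<open>x\<close>, which yields the derivative from the right. Applied to the reflected
function \<open>\<lambda>x. c (- x)\<close> it yields the derivative from the left.\<close>

lemma AE_has_derivative_indefinite_integral:
  fixes c B :: "real \<Rightarrow> real"
  assumes c: "\<And>a b. c integrable_on {a..b}"
    and B: "\<And>x. x > 0 \<Longrightarrow> B x = integral {0..x} c"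
  shows "AE x in lborel. x > 0 \<longrightarrow> (B has_real_derivative c x) (at x)"
proof -
  obtain N where N: "negligible N"
    and right: "\<And>x e. x \<notin> N \<Longrightarrow> 0 < e \<Longrightarrow>
      \<exists>d>0. \<forall>h. 0 < h \<and> h < d \<longrightarrow> norm (integral {x..x + h} c / h - c x) < e"
    using integrable_ccontinuous_explicit[of c] c by (auto simp: cbox_interval divide_inverse_commute)
  have c': "(\<lambda>x. c (- x)) integrable_on {a..b}" for a b
    using c[of "-b" "-a"] Henstock_Kurzweil_Integration.integrable_reflect_real[where f = c and a = "-b" and b = "-a"] by simp
  obtain N' where N': "negligible N'"
    and left: "\<And>x e. x \<notin> N' \<Longrightarrow> 0 < e \<Longrightarrow>
      \<exists>d>0. \<forall>h. 0 < h \<and> h < d \<longrightarrow> norm (integral {x..x + h} (\<lambda>x. c (- x)) / h - c (- x)) < e"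
    using integrable_ccontinuous_explicit[of "\<lambda>x. c (- x)"] c' by (auto simp: cbox_interval divide_inverse_commute)
  have "negligible (uminus ` N')"
    using N' by (intro negligible_differentiable_image_negligible) (auto intro!: derivative_intros differentiable_on_minus simp: id_def[symmetric])
  then have "AE x in lborel. x \<notin> N \<union> uminus ` N'"
    using N by (intro AE_lborel_if_negligible negligible_Un)
  then show ?thesis
  proof eventually_elim
    case (elim x)
    then have x: "x \<notin> N" "- x \<notin> N'"
      using imageI[of "- x" N' uminus] by auto
    show ?case
    proof
      assume "x > 0"
      have diff: "B y - B z = integral {z..y} c" if "0 < z" "z \<le> y" for y z
        using that B[of y] B[of z] Henstock_Kurzweil_Integration.integral_combine[of 0 z y c] c by simp
      show "(B has_real_derivative c x) (at x)"
        unfolding DERIV_def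
      proof (rule LIM_I)
        fix e :: real assume "e > 0"
        obtain d1 where d1: "d1 > 0" "\<And>h. 0 < h \<Longrightarrow> h < d1 \<Longrightarrow> norm (integral {x..x + h} c / h - c x) < e"
          using right[OF x(1) \<open>e > 0\<close>] by blast
        obtain d2 where d2: "d2 > 0"
          "\<And>h. 0 < h \<Longrightarrow> h < d2 \<Longrightarrow> norm (integral {-x..-x + h} (\<lambda>x. c (- x)) / h - c x) < e"
          using left[OF x(2) \<open>e > 0\<close>] by auto
        show "\<exists>s>0. \<forall>h::real. h \<noteq> 0 \<and> norm (h - 0) < s \<longrightarrow> norm ((B (x + h) - B x) / h - c x) < e"
        proof (intro exI[of _ "min x (min d1 d2)"] conjI allI impI)
          show "0 < min x (min d1 d2)" using \<open>x > 0\<close> d1 d2 by simp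
          fix h :: real assume h: "h \<noteq> 0 \<and> norm (h - 0) < min x (min d1 d2)"
          show "norm ((B (x + h) - B x) / h - c x) < e"
          proof (cases "h > 0")
            case True
            then show ?thesis using d1(2)[of h] diff[of x "x + h"] h \<open>x > 0\<close> by simp
          next
            case False
            then have h': "h < 0" "- h < x" "- h < d2" using h by auto
            have "integral {-x..-x + (- h)} (\<lambda>x. c (- x)) = integral {x + h..x} c"
              using Henstock_Kurzweil_Integration.integral_reflect_real[where f = c and a = "x + h" and b = x] by (simp add: algebra_simps)
            then show ?thesis using d2(2)[of "- h"] diff[of "x + h" x] h'
              by (simp add: field_simps minus_divide_left[symmetric] del: minus_divide_left)
          qed
        qed
      qed
    qed
  qed
qed

text \<open>Up to the point \<open>0\<close> the preimage is the image of \<open>E - {0}\<close> under the same map, which is an involution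
there and differentiable.\<close>

lemma negligible_inverse_preimage:
  fixes E :: "real set" and l :: real
  assumes "negligible E" "l \<noteq> 0"
  shows "negligible {t. inverse (l * t) \<in> E}"
proof -
  have "negligible ((\<lambda>s. inverse (l * s)) ` (E - {0}))"
    using assms by (intro negligible_differentiable_image_negligible)
      (auto intro!: differentiable_on_inverse differentiable_on_mult differentiable_on_const differentiable_on_ident
        intro: negligible_subset)
  moreover have "{t. inverse (l * t) \<in> E} \<subseteq> insert 0 ((\<lambda>s. inverse (l * s)) ` (E - {0}))"
  proof
    fix t assume t: "t \<in> {t. inverse (l * t) \<in> E}"
    show "t \<in> insert 0 ((\<lambda>s. inverse (l * s)) ` (E - {0}))"
    proof (cases "t = 0")
      case False
      then show ?thesis using t \<open>l \<noteq> 0\<close>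
        by (auto simp: image_iff intro!: bexI[of _ "inverse (l * t)"])
    qed simp
  qed
  ultimately show ?thesis
    by (metis negligible_insert negligible_subset)
qed


text \<open>The inner integral on the left is the expected value of \<open>g\<close> at the path loss fading from the origin to
\<open>x\<close>. The law \<open>\<nu>\<close> of the values \<open>1 / (t L(z))\<close> satisfies \<open>\<nu> {0<..\<beta>} = B \<beta>\<close>. Its density \<open>b\<close> with respect
to Lebesgue measure comes from the Radon-Nikodym theorem, so that no explicit change of variables in the density of
\<open>H\<close> is needed, and \<open>b = B'\<close> almost everywhere on the positive half-line.\<close>

lemma n_capacity_eq:
  fixes M :: "'w measure" and L :: "real^2 \<Rightarrow> real" and H :: "'w \<Rightarrow> real" and g :: "real \<Rightarrow> real"
  defines "B \<equiv> path_loss_intensity (ccdf M H) L"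
  assumes "prob_space M" and L [measurable]: "L \<in> borel_measurable borel" and Lpos: "\<And>z. L z > 0"
    and Hpos: "\<And>\<omega>. \<omega> \<in> space M \<Longrightarrow> H \<omega> \<ge> 0"
    and dens: "distributed M lborel H (\<lambda>t. ennreal (pH t))"
    and int: "\<And>\<beta>. \<beta> > 0 \<Longrightarrow> integrable lborel (\<lambda>z. ccdf M H (inverse (L z * \<beta>)))"
    and g: "g \<in> borel_measurable (restrict_space borel {0..})" and gpos: "\<And>t. t \<ge> 0 \<Longrightarrow> g t \<ge> 0"
  shows "(\<integral>\<^sup>+x. \<integral>\<^sup>+t. ennreal (g (enn2real (inverse (ennreal (t * L (0 - x)))))) \<partial>distr M borel H \<partial>intensity lam)
    = n_capacity lam B g"
proof -
  interpret prob_space M by fact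
  have H [measurable]: "H \<in> borel_measurable M"
    using dens by (auto simp: distributed_def)
  have pH [measurable]: "(\<lambda>t. ennreal (pH t)) \<in> borel_measurable lborel"
    using dens by (auto simp: distributed_def)
  define \<mu> where "\<mu> = distr M borel H"
  have s\<mu> [measurable_cong, simp]: "sets \<mu> = sets borel" and sp\<mu> [simp]: "space \<mu> = UNIV"
    by (auto simp: \<mu>_def)
  interpret \<mu>: prob_space \<mu> unfolding \<mu>_def by (rule prob_space_distr) simp
  have \<mu>_dens: "\<mu> = density lborel (\<lambda>t. ennreal (pH t))"
    using dens by (auto simp: distributed_def \<mu>_def cong: distr_cong)
  interpret P: pair_sigma_finite "lborel :: (real^2) measure" \<mu> ..
  have \<mu>_null: "emeasure \<mu> E = 0" if "E \<in> sets borel" "negligible E" for E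
    using that AE_lborel_if_negligible[OF that(2)]
    by (auto simp: \<mu>_dens emeasure_density nn_integral_0_iff_AE elim!: eventually_mono)
  have pos: "AE t in \<mu>. t > 0"
  proof -
    have "AE t in \<mu>. t \<ge> 0"
      unfolding \<mu>_def using Hpos by (subst AE_distr_iff) auto
    moreover have "AE t in \<mu>. t \<noteq> 0"
      using \<mu>_null[of "{0}"] by (auto simp: AE_iff_measurable[of "{0}"])
    ultimately show ?thesis by eventually_elim auto
  qed
  define s where "s = (\<lambda>z :: (real^2) \<times> real. inverse (L (fst z) * snd z))"
  have s [measurable]: "s \<in> borel_measurable (lborel \<Otimes>\<^sub>M \<mu>)"
    unfolding s_def by measurable
  define \<nu> where "\<nu> = distr (lborel \<Otimes>\<^sub>M \<mu>) borel s"
  have \<nu>_int: "(\<integral>\<^sup>+u. G u \<partial>\<nu>) = (\<integral>\<^sup>+z. \<integral>\<^sup>+t. G (inverse (L z * t)) \<partial>\<mu> \<partial>lborel)"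
    if [measurable]: "G \<in> borel_measurable borel" for G
    unfolding \<nu>_def by (subst nn_integral_distr, simp, simp, subst \<mu>.nn_integral_fst[symmetric]) (auto simp: s_def)
  have B_nonneg: "B \<beta> \<ge> 0" for \<beta>
    by (auto simp: B_def path_loss_intensity_def ccdf_def intro!: integral_nonneg_AE)
  have \<nu>_B: "emeasure \<nu> {0<..\<beta>} = ennreal (B \<beta>)" if "\<beta> > 0" for \<beta>
  proof -
    have "emeasure \<nu> {0<..\<beta>} = (\<integral>\<^sup>+u. indicator {0<..\<beta>} u \<partial>\<nu>)"
      by (subst nn_integral_indicator) (auto simp: \<nu>_def)
    also have "\<dots> = (\<integral>\<^sup>+z. \<integral>\<^sup>+t. indicator {0<..\<beta>} (inverse (L z * t)) \<partial>\<mu> \<partial>lborel)"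
      by (subst \<nu>_int) auto
    also have "\<dots> = (\<integral>\<^sup>+z. ennreal (ccdf M H (inverse (L z * \<beta>))) \<partial>lborel)"
    proof (intro nn_integral_cong)
      fix z
      have "(\<integral>\<^sup>+t. indicator {0<..\<beta>} (inverse (L z * t)) \<partial>\<mu>) = (\<integral>\<^sup>+t. indicator {inverse (L z * \<beta>)..} t \<partial>\<mu>)"
        using pos
      proof (intro nn_integral_cong_AE, eventually_elim)
        case (elim t)
        then have "inverse (L z * t) \<le> \<beta> \<longleftrightarrow> inverse (L z * \<beta>) \<le> t"
          using Lpos[of z] \<open>\<beta> > 0\<close> by (simp add: field_simps)
        then show ?case using elim Lpos[of z] by (auto simp: indicator_def)
      qed
      also have "\<dots> = emeasure M (H -` {inverse (L z * \<beta>)..} \<inter> space M)"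
        by (simp add: \<mu>_def emeasure_distr)
      also have "\<dots> = ennreal (ccdf M H (inverse (L z * \<beta>)))"
        unfolding ccdf_def emeasure_eq_measure by (auto intro!: arg_cong[where f = prob] arg_cong[where f = ennreal])
      finally show "(\<integral>\<^sup>+t. indicator {0<..\<beta>} (inverse (L z * t)) \<partial>\<mu>) = ennreal (ccdf M H (inverse (L z * \<beta>)))" .
    qed
    also have "\<dots> = ennreal (B \<beta>)"
      unfolding B_def path_loss_intensity_def
      by (rule nn_integral_eq_integral[OF int[OF that]]) (auto simp: ccdf_def)
    finally show ?thesis .
  qed
  have "absolutely_continuous lborel \<nu>"
    unfolding absolutely_continuous_def
  proof
    fix E :: "real set" assume E: "E \<in> null_sets lborel"
    then have [measurable]: "E \<in> sets borel" by (auto simp: null_sets_def)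
    have "negligible E" using E by (auto simp: negligible_iff_null_sets null_sets_completionI)
    have "emeasure \<nu> E = (\<integral>\<^sup>+u. indicator E u \<partial>\<nu>)"
      by (subst nn_integral_indicator) (auto simp: \<nu>_def)
    also have "\<dots> = (\<integral>\<^sup>+z. \<integral>\<^sup>+t. indicator E (inverse (L z * t)) \<partial>\<mu> \<partial>lborel)"
      by (subst \<nu>_int) auto
    also have "\<dots> = (\<integral>\<^sup>+z. 0 \<partial>(lborel :: (real^2) measure))"
    proof (intro nn_integral_cong)
      fix z
      have [measurable]: "{t. inverse (L z * t) \<in> E} \<in> sets borel" by measurable
      have "(\<integral>\<^sup>+t. indicator E (inverse (L z * t)) \<partial>\<mu>) = (\<integral>\<^sup>+t. indicator {t. inverse (L z * t) \<in> E} t \<partial>\<mu>)"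
        by (intro nn_integral_cong) (auto simp: indicator_def)
      also have "\<dots> = emeasure \<mu> {t. inverse (L z * t) \<in> E}"
        by (subst nn_integral_indicator) auto
      also have "\<dots> = 0"
        using negligible_inverse_preimage[OF \<open>negligible E\<close>, of "L z"] Lpos[of z] by (intro \<mu>_null) auto
      finally show "(\<integral>\<^sup>+t. indicator E (inverse (L z * t)) \<partial>\<mu>) = 0" .
    qed
    finally show "E \<in> null_sets \<nu>" by (auto simp: null_sets_def \<nu>_def)
  qed
  then obtain b where b [measurable]: "b \<in> borel_measurable borel" and \<nu>_b: "density lborel b = \<nu>"
    using sigma_finite_measure.Radon_Nikodym[OF lborel.sigma_finite_measure_axioms, of \<nu>] by (auto simp: \<nu>_def)
  define c where "c = (\<lambda>t. if t > 0 then enn2real (b t) else 0)"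
  have c_nonneg: "c t \<ge> 0" for t by (simp add: c_def)
  have [measurable]: "c \<in> borel_measurable borel" unfolding c_def by measurable
  have int_b: "(\<integral>\<^sup>+t. b t * indicator {0<..\<beta>} t \<partial>lborel) = ennreal (B \<beta>)" if "\<beta> > 0" for \<beta>
    using \<nu>_B[OF that] unfolding \<nu>_b[symmetric] by (simp add: emeasure_density)
  \<comment> \<open>\<open>b\<close> takes values in the extended reals; its integrals \<open>B \<beta>\<close> are finite, so it is finite almost everywhere\<close>
  have "AE t in lborel. \<forall>n::nat. b t * indicator {0<..real (Suc n)} t \<noteq> \<infinity>"
    by (intro AE_all_countable[THEN iffD2] allI nn_integral_PInf_AE) (auto simp: int_b simp del: of_nat_Suc)
  then have b_c: "AE t in lborel. t > 0 \<longrightarrow> b t = ennreal (c t)"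
  proof eventually_elim
    case (elim t)
    show ?case
    proof
      assume "t > 0"
      moreover obtain n :: nat where "t \<le> real n" using real_arch_simple by blast
      ultimately have "b t \<noteq> \<infinity>" using elim[rule_format, of n] by (auto simp: indicator_def)
      then show "b t = ennreal (c t)" using \<open>t > 0\<close> by (simp add: c_def less_top)
    qed
  qed
  have int_c: "(\<integral>\<^sup>+t. ennreal (indicator {0..\<beta>} t * c t) \<partial>lborel) = ennreal (B \<beta>)" if "\<beta> > 0" for \<beta>
  proof -
    have "(\<integral>\<^sup>+t. ennreal (indicator {0..\<beta>} t * c t) \<partial>lborel) = (\<integral>\<^sup>+t. b t * indicator {0<..\<beta>} t \<partial>lborel)"
      using b_c by (intro nn_integral_cong_AE, eventually_elim) (auto simp: indicator_def c_def)
    then show ?thesis using int_b[OF that] by simp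
  qed
  have set_int: "set_integrable lborel {0..\<beta>} c" if "\<beta> > 0" for \<beta>
    unfolding set_integrable_def
    by (intro integrableI_nonneg) (auto simp: int_c[OF that] c_nonneg)
  have c_on: "c integrable_on {a..b}" for a b
  proof -
    have R: "c integrable_on {0..max b 1}"
      using set_borel_integral_eq_integral(1)[OF set_int[of "max b 1"]] by simp
    have L: "c integrable_on {min a 0..0}"
      by (rule integrable_eq[of "\<lambda>_. 0"]) (auto simp: c_def)
    have "c integrable_on {min a 0..max b 1}"
      by (rule Henstock_Kurzweil_Integration.integrable_combine[OF _ _ L R]) simp_all
    then show ?thesis
      by (rule integrable_subinterval_real) auto
  qed
  have B_c: "B x = integral {0..x} c" if "x > 0" for x
  proof -
    have "integral {0..x} c = (\<integral>t. indicator {0..x} t * c t \<partial>lborel)"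
      using set_borel_integral_eq_integral(2)[OF set_int[OF that]] by (simp add: set_lebesgue_integral_def)
    also have "\<dots> = enn2real (ennreal (B x))"
      unfolding int_c[OF that, symmetric] by (intro integral_eq_nn_integral) (auto simp: c_nonneg)
    finally show ?thesis using B_nonneg by simp
  qed
  have "AE t in lborel. t > 0 \<longrightarrow> (B has_real_derivative c t) (at t)"
    by (rule AE_has_derivative_indefinite_integral[OF c_on B_c])
  then have deriv: "AE t in lborel. t > 0 \<longrightarrow> deriv B t = c t"
    by eventually_elim (auto intro: DERIV_imp_deriv)
  define G where "G = (\<lambda>t. ennreal (g (max 0 t)) * indicator {0<..} t)"
  have [measurable]: "(\<lambda>t. g (max 0 t)) \<in> borel_measurable borel"
    by (rule measurable_compose[where f = "max 0", OF _ g], rule measurable_restrict_space2) auto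
  have [measurable]: "G \<in> borel_measurable borel" unfolding G_def by measurable
  have "(\<integral>\<^sup>+t\<in>{0<..}. ennreal (deriv B t * g t) \<partial>lborel) = (\<integral>\<^sup>+t. b t * G t \<partial>lborel)"
    using deriv b_c
    by (intro nn_integral_cong_AE, eventually_elim) (auto simp: G_def indicator_def ennreal_mult c_nonneg gpos)
  also have "\<dots> = (\<integral>\<^sup>+t. G t \<partial>\<nu>)"
    unfolding \<nu>_b[symmetric] by (simp add: nn_integral_density)
  also have "\<dots> = (\<integral>\<^sup>+z. \<integral>\<^sup>+t. G (inverse (L z * t)) \<partial>\<mu> \<partial>lborel)"
    by (rule \<nu>_int) simp
  also have "\<dots> = (\<integral>\<^sup>+z. \<integral>\<^sup>+t. G (inverse (L z * t)) \<partial>\<mu> \<partial>distr lborel borel uminus)"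
    using lborel_affine[of "-1" "0 :: real^2"] by (simp add: density_1)
  also have "\<dots> = (\<integral>\<^sup>+x. \<integral>\<^sup>+t. G (inverse (L (0 - x) * t)) \<partial>\<mu> \<partial>lborel)"
    by (subst nn_integral_distr) auto
  also have "\<dots> = (\<integral>\<^sup>+x. \<integral>\<^sup>+t. ennreal (g (enn2real (inverse (ennreal (t * L (0 - x)))))) \<partial>\<mu> \<partial>lborel)"
  proof (rule nn_integral_cong, rule nn_integral_cong_AE)
    fix x
    show "AE t in \<mu>. G (inverse (L (0 - x) * t)) = ennreal (g (enn2real (inverse (ennreal (t * L (0 - x))))))"
      using pos
    proof eventually_elim
      case (elim t)
      then have "t * L (0 - x) > 0" using Lpos by simp
      then have "inverse (t * L (0 - x)) > 0" by (rule positive_imp_inverse_positive)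
      then show ?case
        using inverse_ennreal[OF \<open>t * L (0 - x) > 0\<close>] unfolding G_def mult.commute[of "L (0 - x)"]
        by (simp del: inverse_mult_distrib)
    qed
  qed
  finally have *: "(\<integral>\<^sup>+t\<in>{0<..}. ennreal (deriv B t * g t) \<partial>lborel) = \<dots>" .
  have gm: "(\<lambda>t. g (enn2real t)) \<in> borel_measurable borel"
    by (rule measurable_compose[where f = enn2real, OF _ g], rule measurable_restrict_space2) auto
  have "(\<lambda>x. \<integral>\<^sup>+t. ennreal (g (enn2real (inverse (ennreal (t * L (0 - x)))))) \<partial>\<mu>) \<in> borel_measurable borel"
    by (rule \<mu>.borel_measurable_nn_integral, unfold case_prod_beta',
        rule measurable_compose[OF _ measurable_compose[OF gm measurable_ennreal]]) simp
  then show ?thesis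
    unfolding n_capacity_def * \<mu>_def[symmetric] by (rule nn_integral_intensity)
qed

section \<open>The covariance bound\<close>

text \<open>The second order Campbell formula applies because \<open>mean_served\<close> is a functional of the counts of the
base stations, once it is set to zero on the null event where these are not locally finite.\<close>

lemma (in prob_space) mean_served_pairs_factor:
  fixes X Y :: "nat \<Rightarrow> 'a \<Rightarrow> 'b::euclidean_space" and L :: "'b \<Rightarrow> real"
  assumes ppp: "homogeneous_ppp M lam X" "lam > 0" "homogeneous_ppp M lamB Y" "lamB > 0"
    and ind: "indep_point_processes M Y X"
    and \<mu>: "prob_space \<mu>" "sets \<mu> = sets borel" and L: "L \<in> borel_measurable borel"
    and f: "(\<lambda>s. f (enn2real s)) \<in> borel_measurable borel"
    and \<Gamma> [measurable]: "\<Gamma> \<in> borel_measurable borel"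
  shows "(\<integral>\<^sup>+\<omega>. (\<Sum>j k. of_bool (j \<noteq> k) * (mean_served \<mu> L f (\<lambda>i. Y i \<omega>) (X j \<omega>) * \<Gamma> (X k \<omega>))) \<partial>M) =
    (\<integral>\<^sup>+\<omega>. (\<Sum>j. mean_served \<mu> L f (\<lambda>i. Y i \<omega>) (X j \<omega>)) \<partial>M) * (\<integral>\<^sup>+x. \<Gamma> x \<partial>intensity lam)"
proof -
  have Y: "\<And>i. Y i \<in> borel_measurable M" using ppp(3) by (rule homogeneous_ppp_measurable)
  let ?G = "locally_finite_event M Y" and ?C = "count_events M Y" and ?I = "intensity lam :: 'b measure"
  interpret I: sigma_finite_measure ?I by (rule sigma_finite_intensity)
  define F where "F = (\<lambda>(\<omega>, x). indicator ?G \<omega> * mean_served \<mu> L f (\<lambda>i. Y i \<omega>) x)"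
  have F [measurable]: "F \<in> borel_measurable (?C \<Otimes>\<^sub>M borel)"
    unfolding F_def by (rule mean_served_measurable[OF \<mu> L f])
  have FI [measurable]: "F \<in> borel_measurable (?C \<Otimes>\<^sub>M ?I)"
    using F by (simp cong: measurable_cong_sets sets_pair_measure_cong)
  note good = AE_locally_finite_event[OF ppp(3,4)]
  have one: "(\<integral>\<^sup>+\<omega>. (\<Sum>j. mean_served \<mu> L f (\<lambda>i. Y i \<omega>) (X j \<omega>)) \<partial>M) = (\<integral>\<^sup>+\<omega>. \<integral>\<^sup>+x. F (\<omega>, x) \<partial>?I \<partial>?C)"
    unfolding campbell[OF ppp(1,2) Y ind F, symmetric]
    using good by (intro nn_integral_cong_AE, eventually_elim) (simp add: F_def)
  have "(\<integral>\<^sup>+\<omega>. (\<Sum>j k. of_bool (j \<noteq> k) * (mean_served \<mu> L f (\<lambda>i. Y i \<omega>) (X j \<omega>) * \<Gamma> (X k \<omega>))) \<partial>M) =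
      (\<integral>\<^sup>+\<omega>. (\<Sum>j k. of_bool (j \<noteq> k) * (\<lambda>(\<omega>, x, x'). F (\<omega>, x) * \<Gamma> x') (\<omega>, X j \<omega>, X k \<omega>)) \<partial>M)"
    using good by (intro nn_integral_cong_AE, eventually_elim) (simp add: F_def)
  also have "\<dots> = (\<integral>\<^sup>+\<omega>. \<integral>\<^sup>+x. \<integral>\<^sup>+x'. F (\<omega>, x) * \<Gamma> x' \<partial>?I \<partial>?I \<partial>?C)"
    by (subst campbell_second_order[OF ppp(1,2) Y ind]) (simp_all add: case_prod_beta')
  also have "\<dots> = (\<integral>\<^sup>+\<omega>. \<integral>\<^sup>+x. F (\<omega>, x) * (\<integral>\<^sup>+x'. \<Gamma> x' \<partial>?I) \<partial>?I \<partial>?C)"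
    by (simp add: nn_integral_cmult)
  also have "\<dots> = (\<integral>\<^sup>+\<omega>. (\<integral>\<^sup>+x. F (\<omega>, x) \<partial>?I) * (\<integral>\<^sup>+x'. \<Gamma> x' \<partial>?I) \<partial>?C)"
    using measurable_compose_Pair1[OF _ FI] by (intro nn_integral_cong nn_integral_multc) simp
  also have "\<dots> = (\<integral>\<^sup>+\<omega>. \<integral>\<^sup>+x. F (\<omega>, x) \<partial>?I \<partial>?C) * (\<integral>\<^sup>+x'. \<Gamma> x' \<partial>?I)"
    by (rule nn_integral_multc) measurable
  finally show ?thesis unfolding one .
qed

theorem theorem7:
  fixes M :: "'w measure"
    and lamB lamM :: real
    and Y X :: "nat \<Rightarrow> 'w \<Rightarrow> real^2"
    and L :: "real^2 \<Rightarrow> real"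
    and H :: "'w \<Rightarrow> real"
    and pH :: "real \<Rightarrow> real"
    and h :: "nat option \<times> nat \<Rightarrow> 'w \<Rightarrow> real"
    and f g :: "real \<Rightarrow> real"
  assumes "prob_space M"
    and "lamB > 0" and "lamM > 0"
    and "homogeneous_ppp M lamB Y"
    and "homogeneous_ppp M lamM X"
    and "indep_point_processes M Y X"
    and "L \<in> borel_measurable borel" and "\<And>z. L z > 0"
    and "\<And>\<omega>. \<omega> \<in> space M \<Longrightarrow> H \<omega> \<ge> 0"
    and "\<And>t. pH t \<ge> 0"
    and "distributed M lborel H (\<lambda>t. ennreal (pH t))"
    and "\<And>\<beta>. ccdf M H \<beta> > 0"
    and "iid_fading M H Y X h"
    and "\<And>\<beta>. \<beta> > 0 \<Longrightarrow> integrable lborel (\<lambda>z. ccdf M H (inverse (L z * \<beta>)))"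
    and "\<And>\<beta>. \<beta> > 0 \<Longrightarrow> path_loss_intensity (ccdf M H) L \<beta> > 0"
    and "f \<in> borel_measurable (restrict_space borel {0..})" and "\<And>t. t \<ge> 0 \<Longrightarrow> f t \<ge> 0"
    and "g \<in> borel_measurable (restrict_space borel {0..})" and "\<And>t. t \<ge> 0 \<Longrightarrow> g t \<ge> 0"
    and "mean_capacity M L Y X h f < \<infinity>"
    and "mean_capacity M L Y X h g < \<infinity>"
  shows "ext_cov M (cell_capacity L Y X h f) (cell_capacity L Y X h g)
    \<le> enn2ereal (mean_capacity M L Y X h (\<lambda>t. f t * g t))
      + enn2ereal (mean_capacity M L Y X h f) * enn2ereal (n_capacity lamM (path_loss_intensity (ccdf M H) L) g)
      - enn2ereal (mean_capacity M L Y X h f) * enn2ereal (mean_capacity M L Y X h g)"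
proof -
  interpret prob_space M by fact
  have H [measurable]: "H \<in> borel_measurable M"
    using assms(11) by (auto simp: distributed_def)
  note [measurable] = homogeneous_ppp_measurable[OF assms(4)] homogeneous_ppp_measurable[OF assms(5)] assms(7)
  have f: "(\<lambda>s. f (enn2real s)) \<in> borel_measurable borel"
    by (rule measurable_compose[where f = enn2real, OF _ assms(16)], rule measurable_restrict_space2) auto
  have g: "(\<lambda>s. g (enn2real s)) \<in> borel_measurable borel"
    by (rule measurable_compose[where f = enn2real, OF _ assms(18)], rule measurable_restrict_space2) auto
  let ?\<mu> = "distr M borel H"
  interpret \<mu>: prob_space ?\<mu> by (rule prob_space_distr) simp
  define \<Gamma> where "\<Gamma> = (\<lambda>x. \<integral>\<^sup>+t. demand L g t x \<partial>?\<mu>)"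
  have [measurable]: "\<Gamma> \<in> borel_measurable borel"
    unfolding \<Gamma>_def
    by (intro \<mu>.borel_measurable_nn_integral, unfold case_prod_beta') (intro demand_measurable assms(7) g; simp)
  have \<Gamma>_n: "(\<integral>\<^sup>+x. \<Gamma> x \<partial>intensity lamM) = n_capacity lamM (path_loss_intensity (ccdf M H) L) g"
    unfolding \<Gamma>_def demand_def link_loss_def
    using assms by (intro n_capacity_eq[where pH = pH]) auto
  have "(\<integral>\<^sup>+\<omega>. cell_capacity L Y X h f \<omega> * cell_capacity L Y X h g \<omega> \<partial>M) \<le>
      mean_capacity M L Y X h (\<lambda>t. f t * g t) +
      (\<integral>\<^sup>+\<omega>. (\<Sum>j k. of_bool (j \<noteq> k) * (mean_served ?\<mu> L f (\<lambda>i. Y i \<omega>) (X j \<omega>) * \<Gamma> (X k \<omega>))) \<partial>M)"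
    unfolding \<Gamma>_def
    using assms f g by (intro product_capacity_le) auto
  also have "(\<integral>\<^sup>+\<omega>. (\<Sum>j k. of_bool (j \<noteq> k) * (mean_served ?\<mu> L f (\<lambda>i. Y i \<omega>) (X j \<omega>) * \<Gamma> (X k \<omega>))) \<partial>M) =
      (\<integral>\<^sup>+\<omega>. (\<Sum>j. mean_served ?\<mu> L f (\<lambda>i. Y i \<omega>) (X j \<omega>)) \<partial>M) * (\<integral>\<^sup>+x. \<Gamma> x \<partial>intensity lamM)"
    using assms f \<mu>.prob_space_axioms by (intro mean_served_pairs_factor) auto
  also have "(\<integral>\<^sup>+\<omega>. (\<Sum>j. mean_served ?\<mu> L f (\<lambda>i. Y i \<omega>) (X j \<omega>)) \<partial>M) = mean_capacity M L Y X h f"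
    using assms f by (intro mean_capacity_eq[symmetric]) auto
  finally have "enn2ereal (\<integral>\<^sup>+\<omega>. cell_capacity L Y X h f \<omega> * cell_capacity L Y X h g \<omega> \<partial>M) \<le>
      enn2ereal (mean_capacity M L Y X h (\<lambda>t. f t * g t)) +
      enn2ereal (mean_capacity M L Y X h f) * enn2ereal (n_capacity lamM (path_loss_intensity (ccdf M H) L) g)"
    unfolding \<Gamma>_n by (simp add: less_eq_ennreal.rep_eq plus_ennreal.rep_eq times_ennreal.rep_eq)
  then show ?thesis
    unfolding ext_cov_def mean_capacity_def by (intro ereal_minus_mono) auto
qed

end
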